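(* Let $G$ be a locally compact group. If $G$ has the translate property for one of the Banach spaces $$L^{\infty}(G),\quad \mathcal{C}^b(G),\quad \mathcal{C}^b_{lu}(G),\quad \mathcal{C}^b_{ru}(G),\quad \mathcal{C}^b_u(G),$$ then $G$ has the translate property for all the others.
   Context: Locally compact groups are Hausdorff; $G$ carries a fixed left Haar measure $m_G$. $L^\infty(G)$ is the space of bounded Borel measurable real functions on $G$ modulo null sets (essential supremum norm, almost-everywhere order). $\mathcal{C}^b(G)$ is the space of bounded continuous real functions on $G$ (supremum norm, pointwise order). $\mathcal{C}^b_{ru}(G)$ is the set of $f\in\mathcal{C}^b(G)$ for which $g\mapsto f(g^{-1}\,\cdot\,)$ is sup-norm continuous, $\mathcal{C}^b_{lu}(G)$ is the set of $f\in\mathcal{C}^b(G)$ for which $g\mapsto f(\,\cdot\,g)$ is sup-norm continuous, and $\mathcal{C}^b_u(G)=\mathcal{C}^b_{ru}(G)\cap\mathcal{C}^b_{lu}(G)$. On each of these spaces $G$ acts by left translation, $(gf)(x)=f(g^{-1}x)$. For $E$ one of these spaces, $G$ has the translate property for $E$ if for every non-zero $f\ge 0$ in $E$, all $t_1,\dots,t_n\in\mathbf{R}$ and all $g_1,\dots,g_n\in G$: $\sum_{j=1}^n t_jg_jf\ge 0$ implies $\sum_{j=1}^n t_j\ge 0$. *)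

theory Defs
  imports "HOL-Analysis.Analysis"
begin

(* Groups are types of class topological_group_add. The operation is written additively, as in
   the library, but it is not assumed to be commutative: g + x is the product gx and - g the
   inverse of g. *)

(* Regularity convention: the measure is inner regular with respect to compact sets on all Borel
   sets. In a sigma-compact group this is the same measure as the one normalised by outer
   regularity. In general it is the choice for which "null" and "locally null" agree, so that
   "almost everywhere" below has the meaning customary for L^infinity of a locally compact
   group. With the literal null sets of the outer regular Haar measure, the equivalence of the
   translate properties fails, for instance for SO(3) x R with R discrete. *)
definition left_haar_measure :: "'a::{topological_group_add, t2_space} measure \<Rightarrow> bool" where
  "left_haar_measure M \<longleftrightarrow>
     sets M = sets borel \<and>
     emeasure M UNIV \<noteq> 0 \<and>
     (\<forall>K. compact K \<longrightarrow> emeasure M K < \<infinity>) \<and>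
     (\<forall>A\<in>sets borel. emeasure M A = (SUP K\<in>{K. compact K \<and> K \<subseteq> A}. emeasure M K)) \<and>
     (\<forall>g. \<forall>A\<in>sets borel. emeasure M ((\<lambda>x. g + x) ` A) = emeasure M A)"

definition left_translate :: "'a::group_add \<Rightarrow> ('a \<Rightarrow> real) \<Rightarrow> 'a \<Rightarrow> real" where
  "left_translate g f = (\<lambda>x. f (- g + x))"

definition right_translate :: "'a::group_add \<Rightarrow> ('a \<Rightarrow> real) \<Rightarrow> 'a \<Rightarrow> real" where
  "right_translate g f = (\<lambda>x. f (x + g))"

(* The elements of L^infinity(G) are the classes of these functions modulo equality almost
   everywhere; the classes enter through the filter argument of translate_property. *)
definition Linf_fun :: "('a::topological_space \<Rightarrow> real) set" where
  "Linf_fun = {f \<in> borel_measurable borel. bounded (range f)}"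

abbreviation Cb :: "('a::topological_space \<Rightarrow> real) set" where
  "Cb \<equiv> bcontfun"

(* Bcontfun embeds Cb in the library's normed space of bounded continuous functions with the
   supremum norm, so continuity here is sup-norm continuity of the orbit map. The translates do
   belong to Cb (see left_translate_Cb and right_translate_Cb). *)
definition Cb_ru :: "('a::topological_group_add \<Rightarrow> real) set" where
  "Cb_ru = {f \<in> Cb. continuous_on UNIV (\<lambda>g. Bcontfun (left_translate g f))}"

definition Cb_lu :: "('a::topological_group_add \<Rightarrow> real) set" where
  "Cb_lu = {f \<in> Cb. continuous_on UNIV (\<lambda>g. Bcontfun (right_translate g f))}"

definition Cb_u :: "('a::topological_group_add \<Rightarrow> real) set" where
  "Cb_u = Cb_ru \<inter> Cb_lu"

(* E is a set of functions representing the elements of the space; equality and order are those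
   holding eventually along F. F = ae_filter M gives equality and order almost everywhere, and
   F = top gives pointwise equality and order, since eventually P top means that P holds
   everywhere. *)
definition translate_property :: "('a::group_add \<Rightarrow> real) set \<Rightarrow> 'a filter \<Rightarrow> bool" where
  "translate_property E F \<longleftrightarrow>
     (\<forall>f\<in>E. \<not> (\<forall>\<^sub>F x in F. f x = 0) \<longrightarrow> (\<forall>\<^sub>F x in F. 0 \<le> f x) \<longrightarrow>
        (\<forall>(n::nat) (t::nat \<Rightarrow> real) (g::nat \<Rightarrow> 'a).
           (\<forall>\<^sub>F x in F. 0 \<le> (\<Sum>j<n. t j * left_translate (g j) f x)) \<longrightarrow> 0 \<le> (\<Sum>j<n. t j)))"

lemma left_translate_Cb:
  fixes f :: "'a::topological_group_add \<Rightarrow> real"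
  assumes "f \<in> Cb"
  shows "left_translate g f \<in> Cb"
proof -
  have f: "continuous_on UNIV f" "bounded (range f)"
    using assms by (simp_all add: bcontfun_def)
  have "continuous_on UNIV (\<lambda>x. - g + x)"
    by (intro continuous_intros)
  from continuous_on_compose2[OF f(1) this] have "continuous_on UNIV (\<lambda>x. f (- g + x))"
    by simp
  moreover have "bounded (range (\<lambda>x. f (- g + x)))"
    by (rule bounded_subset[OF f(2)]) blast
  ultimately show ?thesis
    by (simp add: bcontfun_def left_translate_def)
qed

lemma right_translate_Cb:
  fixes f :: "'a::topological_group_add \<Rightarrow> real"
  assumes "f \<in> Cb"
  shows "right_translate g f \<in> Cb"
proof -
  have f: "continuous_on UNIV f" "bounded (range f)"
    using assms by (simp_all add: bcontfun_def)
  have "continuous_on UNIV (\<lambda>x. x + g)"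
    by (intro continuous_intros)
  from continuous_on_compose2[OF f(1) this] have "continuous_on UNIV (\<lambda>x. f (x + g))"
    by simp
  moreover have "bounded (range (\<lambda>x. f (x + g)))"
    by (rule bounded_subset[OF f(2)]) blast
  ultimately show ?thesis
    by (simp add: bcontfun_def right_translate_def)
qed

(* The translation action is well defined on classes modulo null sets. *)
lemma left_translate_AE_cong:
  fixes M :: "'a::{topological_group_add, t2_space} measure"
  assumes M: "left_haar_measure M" and eq: "AE x in M. f x = h x"
  shows "AE x in M. left_translate g f x = left_translate g h x"
proof -
  have s: "sets M = sets borel" using M by (simp add: left_haar_measure_def)
  have sp: "space M = UNIV" using sets_eq_imp_space_eq[OF s] by simp
  obtain N where N: "N \<in> null_sets M" and "{x \<in> space M. f x \<noteq> h x} \<subseteq> N"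
    using eq unfolding eventually_ae_filter by blast
  then have fh: "f x = h x" if "x \<notin> N" for x
    using that sp by blast
  have NB: "N \<in> sets borel" using null_setsD2[OF N] s by simp
  have img: "(\<lambda>x. g + x) ` N = (\<lambda>x. - g + x) -` N"
  proof (intro set_eqI iffI)
    fix y assume "y \<in> (\<lambda>x. - g + x) -` N"
    then have "g + (- g + y) \<in> (\<lambda>x. g + x) ` N" by (intro imageI) simp
    then show "y \<in> (\<lambda>x. g + x) ` N" by (simp add: add.assoc[symmetric])
  qed (auto simp: add.assoc[symmetric])
  have "(\<lambda>x. - g + x) \<in> borel_measurable borel"
    by (intro borel_measurable_continuous_onI continuous_intros)
  then have "(\<lambda>x. - g + x) -` N \<in> sets borel"
    using NB by (rule measurable_sets_borel)
  moreover have "emeasure M ((\<lambda>x. g + x) ` N) = 0"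
    using M NB null_setsD1[OF N] by (simp add: left_haar_measure_def)
  ultimately have "(\<lambda>x. - g + x) -` N \<in> null_sets M"
    using s img by (simp add: null_sets_def)
  then show ?thesis
  proof (rule AE_I')
    show "{x \<in> space M. left_translate g f x \<noteq> left_translate g h x} \<subseteq> (\<lambda>x. - g + x) -` N"
      using fh unfolding left_translate_def by blast
  qed
qed

end

theory Submission
  imports Defs
begin

text \<open>
  The properties pass to smaller spaces, and right convolution with a bump function, which
  commutes with left translations, carries a counterexample from \<open>L\<^sup>\<infinity>\<close> to the left uniformly
  continuous functions. The remaining implication, from uniformly continuous to left uniformly
  continuous functions, needs left convolution, which does not commute with left translations.

  It uses that the translate property makes \<open>G\<close> amenable: a spectral gap for left translations on
  \<open>L\<^sup>2\<close> would turn the Green function of a random walk into a counterexample, so there are almost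
  invariant \<open>\<theta> \<ge> 0\<close> with compact support. Now let \<open>f\<close> be left uniformly continuous with
  \<open>\<Sum>j. t j g\<^sub>j f \<ge> 0\<close> and \<open>T = \<Sum>j. t j < 0\<close>. Convolving on the left with \<open>\<phi>\<close> gives
  \<open>T (\<phi> * f) + \<kappa> * f \<ge> 0\<close>, where \<open>\<kappa>\<close> has integral zero. Up to a small error \<open>\<kappa>\<close> is a combination
  of translates of one bump function with coefficient sum zero, so averaging with \<open>\<theta>\<close> makes the
  second term small compared with translates of the uniformly continuous function \<open>\<phi> * f\<close>, and a
  combination of these with negative total weight is nonnegative.
\<close>

section \<open>Functions with compact support\<close>

text \<open>Neither \<open>f\<close> nor \<open>\<phi> * f\<close> has a positive lower bound, so an
  error that is merely small in the supremum norm cannot be absorbed. Every error is instead bounded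
  by a small multiple of translates of one fixed bump function \<open>\<phi>\<close>. As
  \<open>f \<ge> 0\<close>, convolution turns this into a bound by translates of
  \<open>\<phi> * f\<close>; adding it to a combination of such translates changes the total
  coefficient only slightly. The dominating translates must be fixed before the error is made small,
  hence the order of the quantifiers in the approximation lemmas.

  The translate property speaks of translates of a single function. The bump function
  \<open>\<psi>\<close> that approximates \<open>\<kappa>\<close> is a different one, so
  \<open>\<psi> * f\<close> has to be dominated by translates of \<open>\<phi> * f\<close> as well.

  A left translation of \<open>f\<close> appears in \<open>\<phi> * f\<close> as a right translation
  of \<open>\<phi>\<close>. This brings in the modular function, whose factors cancel in the
  integral and leave \<open>\<kappa>\<close> with integral zero. That right translation scales the
  integral by a constant is derived from the same approximation by left translates.\<close>

definition Cc :: "('a::topological_space \<Rightarrow> real) set" where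
  "Cc = {f. continuous_on UNIV f \<and> (\<exists>K. compact K \<and> (\<forall>x. x \<notin> K \<longrightarrow> f x = 0))}"

lemma CcI: "continuous_on UNIV f \<Longrightarrow> compact K \<Longrightarrow> (\<And>x. x \<notin> K \<Longrightarrow> f x = 0) \<Longrightarrow> f \<in> Cc"
  unfolding Cc_def by blast

lemma CcE:
  assumes "f \<in> Cc"
  obtains K where "compact K" "\<And>x. x \<notin> K \<Longrightarrow> f x = 0"
  using assms unfolding Cc_def by blast

lemma Cc_continuous: "f \<in> Cc \<Longrightarrow> continuous_on UNIV f"
  unfolding Cc_def by blast

lemma Cc_compose2:
  assumes "f \<in> Cc" "g \<in> Cc" "continuous_on UNIV h" "h (0, 0) = 0"
  shows "(\<lambda>x. h (f x, g x)) \<in> Cc"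
proof -
  obtain K where K: "compact K" "\<And>x. x \<notin> K \<Longrightarrow> f x = 0" using CcE[OF assms(1)] by blast
  obtain L where L: "compact L" "\<And>x. x \<notin> L \<Longrightarrow> g x = 0" using CcE[OF assms(2)] by blast
  show ?thesis
  proof (rule CcI)
    show "continuous_on UNIV (\<lambda>x. h (f x, g x))"
      by (rule continuous_on_compose2[OF assms(3)])
        (auto intro!: continuous_on_Pair Cc_continuous assms)
    show "compact (K \<union> L)" using K L by auto
    show "h (f x, g x) = 0" if "x \<notin> K \<union> L" for x using that K L assms(4) by auto
  qed
qed

lemma Cc_add: "f \<in> Cc \<Longrightarrow> g \<in> Cc \<Longrightarrow> (\<lambda>x. f x + g x) \<in> Cc"
  using Cc_compose2[of f g "\<lambda>p. fst p + snd p"] by (simp add: continuous_intros)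

lemma Cc_diff: "f \<in> Cc \<Longrightarrow> g \<in> Cc \<Longrightarrow> (\<lambda>x. f x - g x) \<in> Cc"
  using Cc_compose2[of f g "\<lambda>p. fst p - snd p"] by (simp add: continuous_intros)

lemma Cc_mult: "f \<in> Cc \<Longrightarrow> g \<in> Cc \<Longrightarrow> (\<lambda>x. f x * g x) \<in> Cc"
  using Cc_compose2[of f g "\<lambda>p. fst p * snd p"] by (simp add: continuous_intros)

lemma Cc_cmult: "f \<in> Cc \<Longrightarrow> (\<lambda>x. c * f x) \<in> Cc"
  using Cc_compose2[of f f "\<lambda>p. c * snd p"] by (simp add: continuous_intros)

lemma Cc_abs: "f \<in> Cc \<Longrightarrow> (\<lambda>x. \<bar>f x\<bar>) \<in> Cc"
  using Cc_compose2[of f f "\<lambda>p. \<bar>snd p\<bar>"] by (simp add: continuous_intros)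

lemma Cc_power2: "f \<in> Cc \<Longrightarrow> (\<lambda>x. (f x)\<^sup>2) \<in> Cc"
  unfolding power2_eq_square by (rule Cc_mult)

lemma Cc_zero: "(\<lambda>x. 0) \<in> Cc"
  by (rule CcI[of _ "{}"]) auto

lemma Cc_sum: "(\<And>i. i \<in> A \<Longrightarrow> f i \<in> Cc) \<Longrightarrow> (\<lambda>x. \<Sum>i\<in>A. f i x) \<in> Cc"
  by (induction A rule: infinite_finite_induct) (auto intro: Cc_zero Cc_add)

lemma Cc_mult_continuous:
  assumes "f \<in> Cc" "continuous_on UNIV g"
  shows "(\<lambda>x. f x * g x) \<in> Cc"
proof -
  obtain K where K: "compact K" "\<And>x. x \<notin> K \<Longrightarrow> f x = 0" using CcE[OF assms(1)] by blast
  show ?thesis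
    by (rule CcI[OF _ K(1)]) (auto intro!: continuous_on_mult Cc_continuous[OF assms(1)] assms(2) simp: K(2))
qed

lemma Cc_bounded:
  assumes "f \<in> Cc"
  obtains B where "B > 0" "\<And>x. \<bar>f x\<bar> \<le> B"
proof -
  obtain K where K: "compact K" "\<And>x. x \<notin> K \<Longrightarrow> f x = 0" using CcE[OF assms] by blast
  have "compact (f ` K)"
    by (rule compact_continuous_image[OF continuous_on_subset[OF Cc_continuous[OF assms]] K(1)]) auto
  then have "bounded (f ` K)" by (rule compact_imp_bounded)
  then obtain B where B: "B > 0" "\<And>y. y \<in> f ` K \<Longrightarrow> norm y \<le> B" by (auto simp: bounded_pos)
  show ?thesis
  proof (rule that[OF B(1)])
    show "\<bar>f x\<bar> \<le> B" for x
      using B K(2)[of x] by (cases "x \<in> K") auto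
  qed
qed

lemma Cc_comp_homeo:
  fixes f :: "'a::topological_space \<Rightarrow> real" and h k :: "'a \<Rightarrow> 'a"
  assumes "f \<in> Cc" "continuous_on UNIV h" "continuous_on UNIV k" "\<And>x. k (h x) = x"
  shows "(\<lambda>x. f (h x)) \<in> Cc"
proof -
  obtain K where K: "compact K" "\<And>x. x \<notin> K \<Longrightarrow> f x = 0" using CcE[OF assms(1)] by blast
  show ?thesis
  proof (rule CcI)
    show "continuous_on UNIV (\<lambda>x. f (h x))"
      by (rule continuous_on_compose2[OF Cc_continuous[OF assms(1)] assms(2)]) auto
    show "compact (k ` K)"
      by (rule compact_continuous_image[OF continuous_on_subset[OF assms(3)] K(1)]) auto
    show "f (h x) = 0" if "x \<notin> k ` K" for x
      using that assms(4)[of x] K(2)[of "h x"] by (metis imageI)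
  qed
qed

lemma Cc_left:
  fixes f :: "'a::topological_group_add \<Rightarrow> real"
  shows "f \<in> Cc \<Longrightarrow> (\<lambda>x. f (a + x)) \<in> Cc"
  by (rule Cc_comp_homeo[of f "\<lambda>x. a + x" "\<lambda>x. - a + x"])
    (auto intro!: continuous_intros simp: add.assoc[symmetric])

lemma Cc_right:
  fixes f :: "'a::topological_group_add \<Rightarrow> real"
  shows "f \<in> Cc \<Longrightarrow> (\<lambda>x. f (x + a)) \<in> Cc"
  by (rule Cc_comp_homeo[of f "\<lambda>x. x + a" "\<lambda>x. x + - a"])
    (auto intro!: continuous_intros simp: add.assoc)

lemma Cc_uminus:
  fixes f :: "'a::topological_group_add \<Rightarrow> real"
  shows "f \<in> Cc \<Longrightarrow> (\<lambda>x. f (- x)) \<in> Cc"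
  by (rule Cc_comp_homeo[of f uminus uminus]) (auto intro!: continuous_intros)

lemma Cc_reflect:
  fixes f :: "'a::topological_group_add \<Rightarrow> real"
  shows "f \<in> Cc \<Longrightarrow> (\<lambda>y. f (- y + x)) \<in> Cc"
  using Cc_uminus[OF Cc_right[of f x]] by simp

section \<open>Compact and open sets under the group operations\<close>

lemma compact_plus_set:
  fixes S T :: "'a::topological_group_add set"
  assumes "compact S" "compact T"
  shows "compact ((\<lambda>(x, y). x + y) ` (S \<times> T))"
  by (rule compact_continuous_image)
    (auto intro!: compact_Times assms continuous_intros simp: case_prod_beta)

lemma open_left_translate:
  fixes U :: "'a::topological_group_add set"
  assumes "open U" shows "open {x. a + x \<in> U}"
proof -
  have "open ((\<lambda>x. a + x) -` U)"
    by (rule open_vimage[OF assms]) (intro continuous_intros)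
  then show ?thesis by (simp add: vimage_def)
qed

lemma open_right_translate:
  fixes U :: "'a::topological_group_add set"
  assumes "open U" shows "open {x. x + a \<in> U}"
proof -
  have "open ((\<lambda>x. x + a) -` U)"
    by (rule open_vimage[OF assms]) (intro continuous_intros)
  then show ?thesis by (simp add: vimage_def)
qed

lemma open_uminus:
  fixes U :: "'a::topological_group_add set"
  assumes "open U" shows "open {x. - x \<in> U}"
proof -
  have "open (uminus -` U)"
    by (rule open_vimage[OF assms]) (intro continuous_intros)
  then show ?thesis by (simp add: vimage_def)
qed

lemma symmetric_nbhd:
  fixes U :: "'a::topological_group_add set"
  assumes "open U" "0 \<in> U"
  obtains V where "open V" "0 \<in> V" "V \<subseteq> U" "\<And>v. v \<in> V \<Longrightarrow> - v \<in> V"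
proof
  show "open (U \<inter> {x. - x \<in> U})" using open_uminus[OF assms(1)] assms by auto
qed (use assms in auto)

text \<open>The tube lemma gives a neighbourhood that works for \<open>x\<close> in the compact set
  \<open>K\<close> only. Making it symmetric covers the case \<open>v + x \<in> K\<close>, by
  applying the bound to \<open>- v\<close> and \<open>v + x\<close>; if both points lie outside
  \<open>K\<close>, both values vanish.\<close>

lemma Cc_uniform_left:
  fixes f :: "'a::topological_group_add \<Rightarrow> real"
  assumes f: "f \<in> Cc" and e: "e > 0"
  obtains U where "open U" "0 \<in> U" "\<And>v x. v \<in> U \<Longrightarrow> \<bar>f (v + x) - f x\<bar> < e"
proof -
  obtain K where K: "compact K" "\<And>x. x \<notin> K \<Longrightarrow> f x = 0" using CcE[OF f] by blast
  let ?W = "{p. \<bar>f (fst p + snd p) - f (snd p)\<bar> < e}"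
  have c: "continuous_on UNIV (\<lambda>p. \<bar>f (fst p + snd p) - f (snd p)\<bar>)"
    by (intro continuous_intros continuous_on_compose2[OF Cc_continuous[OF f]]) auto
  have "open ?W"
    by (rule open_Collect_less[OF c]) auto
  moreover have "{0} \<times> K \<subseteq> ?W" using e by auto
  ultimately have "\<exists>U0. 0 \<in> U0 \<and> open U0 \<and> U0 \<times> K \<subseteq> ?W"
    by (rule Elementary_Topology.tube_lemma[OF K(1)])
  then obtain U0 where U0: "0 \<in> U0" "open U0" "U0 \<times> K \<subseteq> ?W"
    by (elim exE conjE)
  obtain U where U: "open U" "0 \<in> U" "U \<subseteq> U0" "\<And>v. v \<in> U \<Longrightarrow> - v \<in> U"
    by (rule symmetric_nbhd[OF U0(2,1)]) (rule that)
  have *: "\<bar>f (v + x) - f x\<bar> < e" if "v \<in> U" "x \<in> K" for v x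
    using subsetD[OF U0(3), of "(v, x)"] U(3) that by auto
  show ?thesis
  proof (rule that[OF U(1,2)])
    fix v x assume v: "v \<in> U"
    consider "x \<in> K" | "v + x \<in> K" | "x \<notin> K" "v + x \<notin> K" by blast
    then show "\<bar>f (v + x) - f x\<bar> < e"
    proof cases
      case 1 then show ?thesis using * v by blast
    next
      case 2
      from *[OF U(4)[OF v] 2] show ?thesis by (simp add: add.assoc[symmetric] abs_minus_commute)
    next
      case 3 then show ?thesis using K e by simp
    qed
  qed
qed

lemma Cc_uniform_right:
  fixes f :: "'a::topological_group_add \<Rightarrow> real"
  assumes f: "f \<in> Cc" and e: "e > 0"
  obtains U where "open U" "0 \<in> U" "\<And>v x. v \<in> U \<Longrightarrow> \<bar>f (x + v) - f x\<bar> < e"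
proof -
  obtain U where U: "open U" "0 \<in> U" "\<And>v x. v \<in> U \<Longrightarrow> \<bar>f (- (v + x)) - f (- x)\<bar> < e"
    using Cc_uniform_left[OF Cc_uminus[OF f] e] by blast
  show ?thesis
  proof (rule that)
    show "open {x. - x \<in> U}" "0 \<in> {x. - x \<in> U}" using open_uminus[OF U(1)] U(2) by auto
    fix v x assume "v \<in> {x. - x \<in> U}"
    then show "\<bar>f (x + v) - f x\<bar> < e"
      using U(3)[of "- v" "- x"] by (simp add: minus_add)
  qed
qed

section \<open>Uniform continuity and continuous orbit maps\<close>

lemma bcontfunI_bound:
  fixes f :: "'a::topological_space \<Rightarrow> real"
  assumes "continuous_on UNIV f" "\<And>x. \<bar>f x\<bar> \<le> B"
  shows "f \<in> bcontfun"
  using assms unfolding bcontfun_def bounded_iff by auto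

lemma Cc_bcontfun: "f \<in> Cc \<Longrightarrow> f \<in> bcontfun"
  using Cc_bounded[of f] bcontfunI_bound[OF Cc_continuous, of f] by blast

lemma bcontfun_bound:
  fixes f :: "'a::topological_space \<Rightarrow> real"
  assumes "f \<in> bcontfun"
  obtains B where "B > 0" "\<And>x. \<bar>f x\<bar> \<le> B"
  using assms unfolding bcontfun_def bounded_pos by auto

lemma continuous_Bcontfun_family:
  fixes T :: "'a::topological_group_add \<Rightarrow> 'a \<Rightarrow> real"
  assumes T: "\<And>g. T g \<in> bcontfun"
    and U: "\<And>e g. e > 0 \<Longrightarrow> \<exists>U. open U \<and> g \<in> U \<and> (\<forall>h\<in>U. \<forall>x. \<bar>T h x - T g x\<bar> \<le> e)"
  shows "continuous_on UNIV (\<lambda>g. Bcontfun (T g))"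
  unfolding continuous_on_def
proof (intro ballI tendstoI)
  fix g :: 'a and e :: real assume "e > 0"
  then obtain U where U: "open U" "g \<in> U" "\<And>h x. h \<in> U \<Longrightarrow> \<bar>T h x - T g x\<bar> \<le> e/2"
    using U[of "e/2" g] by auto
  have "dist (Bcontfun (T h)) (Bcontfun (T g)) < e" if "h \<in> U" for h
  proof -
    have "dist (Bcontfun (T h)) (Bcontfun (T g)) \<le> e/2"
      by (rule dist_bound) (use U(3)[OF that] T in \<open>simp add: Bcontfun_inverse dist_real_def\<close>)
    then show ?thesis using \<open>e > 0\<close> by linarith
  qed
  then show "\<forall>\<^sub>F h in at g within UNIV. dist (Bcontfun (T h)) (Bcontfun (T g)) < e"
    unfolding eventually_at_topological using U(1,2) by blast
qed

text \<open>At \<open>x\<close>, the translates by \<open>h\<close> and \<open>g\<close> differ by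
  the increment of \<open>f\<close> at \<open>- g + x\<close> under the left factor
  \<open>- h + g\<close>, which is near 0 when \<open>h\<close> is near \<open>g\<close>. Uniformity
  at the identity therefore gives continuity of the orbit map everywhere.\<close>

lemma Cb_ruI:
  fixes f :: "'a::topological_group_add \<Rightarrow> real"
  assumes f: "f \<in> Cb"
    and U: "\<And>e. e > 0 \<Longrightarrow> \<exists>U. open U \<and> 0 \<in> U \<and> (\<forall>v\<in>U. \<forall>x. \<bar>f (v + x) - f x\<bar> \<le> e)"
  shows "f \<in> Cb_ru"
proof -
  have "continuous_on UNIV (\<lambda>g. Bcontfun (left_translate g f))"
  proof (rule continuous_Bcontfun_family)
    fix e :: real and g :: 'a assume "e > 0"
    from U[OF this] obtain U where U: "open U" "0 \<in> U" "\<And>v x. v \<in> U \<Longrightarrow> \<bar>f (v + x) - f x\<bar> \<le> e"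
      by auto
    let ?V = "{h. - h + g \<in> U}"
    have "\<bar>left_translate h f x - left_translate g f x\<bar> \<le> e" if "h \<in> ?V" for h x
      using U(3)[of "- h + g" "- g + x"] that
      by (simp add: left_translate_def add.assoc)
    moreover have "open ?V"
      using open_uminus[OF open_right_translate[OF U(1)]] by simp
    moreover have "g \<in> ?V" using U(2) by simp
    ultimately show "\<exists>U. open U \<and> g \<in> U \<and> (\<forall>h\<in>U. \<forall>x. \<bar>left_translate h f x - left_translate g f x\<bar> \<le> e)"
      by blast
  qed (rule left_translate_Cb[OF f])
  then show ?thesis using f by (simp add: Cb_ru_def)
qed

lemma Cb_luI:
  fixes f :: "'a::topological_group_add \<Rightarrow> real"
  assumes f: "f \<in> Cb"
    and U: "\<And>e. e > 0 \<Longrightarrow> \<exists>U. open U \<and> 0 \<in> U \<and> (\<forall>v\<in>U. \<forall>x. \<bar>f (x + v) - f x\<bar> \<le> e)"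
  shows "f \<in> Cb_lu"
proof -
  have "continuous_on UNIV (\<lambda>g. Bcontfun (right_translate g f))"
  proof (rule continuous_Bcontfun_family)
    fix e :: real and g :: 'a assume "e > 0"
    from U[OF this] obtain U where U: "open U" "0 \<in> U" "\<And>v x. v \<in> U \<Longrightarrow> \<bar>f (x + v) - f x\<bar> \<le> e"
      by auto
    let ?V = "{h. - g + h \<in> U}"
    have "\<bar>right_translate h f x - right_translate g f x\<bar> \<le> e" if "h \<in> ?V" for h x
      using U(3)[of "- g + h" "x + g"] that
      by (simp add: right_translate_def add.assoc)
    moreover have "open ?V"
      using open_left_translate[OF U(1)] by simp
    moreover have "g \<in> ?V" using U(2) by simp
    ultimately show "\<exists>U. open U \<and> g \<in> U \<and> (\<forall>h\<in>U. \<forall>x. \<bar>right_translate h f x - right_translate g f x\<bar> \<le> e)"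
      by blast
  qed (rule right_translate_Cb[OF f])
  then show ?thesis using f by (simp add: Cb_lu_def)
qed

lemma Cb_luD:
  fixes f :: "'a::topological_group_add \<Rightarrow> real"
  assumes f: "f \<in> Cb_lu" and e: "e > 0"
  obtains U where "open U" "0 \<in> U" "\<And>v x. v \<in> U \<Longrightarrow> \<bar>f (x + v) - f x\<bar> < e"
proof -
  have fC: "f \<in> Cb" using f by (simp add: Cb_lu_def)
  have "continuous_on UNIV (\<lambda>g. Bcontfun (right_translate g f))"
    using f by (simp add: Cb_lu_def)
  then have "((\<lambda>g. Bcontfun (right_translate g f)) \<longlongrightarrow> Bcontfun (right_translate 0 f)) (at 0)"
    unfolding continuous_on_def by auto
  from tendstoD[OF this e] obtain U where U: "open U" "0 \<in> U"
    "\<And>v. v \<in> U \<Longrightarrow> v \<noteq> 0 \<Longrightarrow> dist (Bcontfun (right_translate v f)) (Bcontfun (right_translate 0 f)) < e"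
    unfolding eventually_at_topological by blast
  show ?thesis
  proof (rule that[OF U(1,2)])
    fix v x assume "v \<in> U"
    show "\<bar>f (x + v) - f x\<bar> < e"
    proof (cases "v = 0")
      case False
      from dist_fun_lt_imp_dist_val_lt[OF U(3)[OF \<open>v \<in> U\<close> False], of x] show ?thesis
        by (simp add: Bcontfun_inverse right_translate_Cb fC) (simp add: right_translate_def dist_real_def)
    qed (use e in simp)
  qed
qed

lemma continuous_on_uniform_left:
  fixes f :: "'a::topological_group_add \<Rightarrow> real"
  assumes "\<And>e. e > 0 \<Longrightarrow> \<exists>U. open U \<and> 0 \<in> U \<and> (\<forall>v\<in>U. \<forall>x. \<bar>f (v + x) - f x\<bar> \<le> e)"
  shows "continuous_on UNIV f"
  unfolding continuous_on_def
proof (intro ballI tendstoI)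
  fix a :: 'a and e :: real assume e: "e > 0"
  then obtain U where U: "open U" "0 \<in> U" "\<And>v x. v \<in> U \<Longrightarrow> \<bar>f (v + x) - f x\<bar> \<le> e/2"
    using assms[of "e/2"] by auto
  have "dist (f x) (f a) < e" if "x + - a \<in> U" for x
    using U(3)[OF that, of a] e by (simp add: add.assoc dist_real_def)
  then show "\<forall>\<^sub>F x in at a within UNIV. dist (f x) (f a) < e"
    unfolding eventually_at_topological
    using open_right_translate[OF U(1), of "- a"] U(2) by (intro exI[of _ "{x. x + - a \<in> U}"]) auto
qed

lemma continuous_on_uniform_right:
  fixes f :: "'a::topological_group_add \<Rightarrow> real"
  assumes "\<And>e. e > 0 \<Longrightarrow> \<exists>U. open U \<and> 0 \<in> U \<and> (\<forall>v\<in>U. \<forall>x. \<bar>f (x + v) - f x\<bar> \<le> e)"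
  shows "continuous_on UNIV f"
  unfolding continuous_on_def
proof (intro ballI tendstoI)
  fix a :: 'a and e :: real assume e: "e > 0"
  then obtain U where U: "open U" "0 \<in> U" "\<And>v x. v \<in> U \<Longrightarrow> \<bar>f (x + v) - f x\<bar> \<le> e/2"
    using assms[of "e/2"] by auto
  have "dist (f x) (f a) < e" if "- a + x \<in> U" for x
    using U(3)[OF that, of a] e by (simp add: add.assoc[symmetric] dist_real_def)
  then show "\<forall>\<^sub>F x in at a within UNIV. dist (f x) (f a) < e"
    unfolding eventually_at_topological
    using open_left_translate[OF U(1), of "- a"] U(2) by (intro exI[of _ "{x. - a + x \<in> U}"]) auto
qed

section \<open>Bump functions and domination by their translates\<close>

lemma compact_nbhd:
  assumes "locally_compact_space (euclidean :: 'a::{topological_group_add, t2_space} topology)"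
  obtains W L :: "'a::{topological_group_add, t2_space} set"
    where "open W" "compact L" "0 \<in> W" "W \<subseteq> L"
  using assms unfolding locally_compact_space_def by (simp add: compactin_euclidean_iff) meson

text \<open>Locally compact Hausdorff spaces are completely regular, so 0 can be separated from the
  complement of \<open>V \<inter> W\<close>. Intersecting with the relatively compact
  \<open>W\<close> makes the support compact.\<close>

lemma bump_exists:
  fixes V :: "'a::{topological_group_add, t2_space} set"
  assumes lc: "locally_compact_space (euclidean :: 'a topology)"
    and V: "open V" "0 \<in> V"
  obtains \<phi> :: "'a \<Rightarrow> real" where "\<phi> \<in> Cc" "\<And>x. 0 \<le> \<phi> x" "\<And>x. \<phi> x \<le> 1" "\<phi> 0 = 1" "\<And>x. x \<notin> V \<Longrightarrow> \<phi> x = 0"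
proof -
  obtain W K :: "'a set" where WK: "open W" "compact K" "0 \<in> W" "W \<subseteq> K"
    by (rule compact_nbhd[OF lc]) (rule that)
  have "completely_regular_space (euclidean :: 'a topology)"
  proof (rule locally_compact_regular_imp_completely_regular_space[OF lc])
    show "Hausdorff_space (euclidean :: 'a topology) \<or> regular_space (euclidean :: 'a topology)"
      by (rule disjI1) (simp add: Hausdorff_space_def disjnt_def, meson hausdorff)
  qed
  moreover have "closed (- (V \<inter> W))" using open_Int[OF V(1) WK(1)] by (rule closed_Compl)
  moreover have "0 \<in> topspace euclidean - - (V \<inter> W)" using V WK by simp
  ultimately obtain f :: "'a \<Rightarrow> real" where
    f: "continuous_map euclidean (top_of_set {0..1}) f" "f 0 = 0" "f ` (- (V \<inter> W)) \<subseteq> {1}"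
    using completely_regular_space_def[of "euclidean :: 'a topology"] closed_closedin[of "- (V \<inter> W)"] by blast
  have fc: "continuous_on UNIV f" and f01: "\<And>x. f x \<in> {0..1}"
    using f(1) by (auto simp: continuous_map_in_subtopology)
  have f1: "f x = 1" if "x \<notin> V \<inter> W" for x using f(3) that by blast
  show ?thesis
  proof (rule that[of "\<lambda>x. 1 - f x"])
    show "(\<lambda>x. 1 - f x) \<in> Cc"
      by (rule CcI[OF _ WK(2)]) (use f1 WK(4) in \<open>auto intro!: continuous_intros fc\<close>)
  qed (use f01 f(2) f1 in auto)
qed

text \<open>This replaces the constant 1 on a compact set by a combination of translates of
  \<open>\<phi>\<close>. Unlike a constant, such a bound becomes a combination of translates of
  \<open>conv \<phi> f\<close> after convolution with \<open>f \<ge> 0\<close>.\<close>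

lemma Cc_dominated_cover:
  fixes \<phi> :: "'a::topological_group_add \<Rightarrow> real"
  assumes \<phi>: "\<phi> \<in> Cc" "\<And>x. 0 \<le> \<phi> x" "\<phi> 0 > 0" and K: "compact K"
  obtains C :: real and n :: nat and y where "C > 0" "\<And>x. x \<in> K \<Longrightarrow> 1 \<le> C * (\<Sum>l<n. \<phi> (- y l + x))"
proof -
  let ?O = "{x. \<phi> x > \<phi> 0 / 2}"
  have O: "open ?O"
    by (rule open_Collect_less) (auto intro!: continuous_on_const Cc_continuous \<phi>)
  \<comment> \<open>Each point of \<open>K\<close> will lie in a translate of the set where
    \<open>\<phi>\<close> exceeds half of its value at 0, and one such summand suffices.\<close>
  define C where "C = 2 / \<phi> 0"
  have C: "C > 0" using \<phi> by (simp add: C_def)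
  have "\<And>a. a \<in> K \<Longrightarrow> open {x. - a + x \<in> ?O}" using open_left_translate[OF O] by simp
  moreover have "K \<subseteq> (\<Union>a\<in>K. {x. - a + x \<in> ?O})" using \<phi>(3) by auto
  ultimately obtain A where A: "A \<subseteq> K" "finite A" "K \<subseteq> (\<Union>a\<in>A. {x. - a + x \<in> ?O})"
    using compactE_image[OF K, of K "\<lambda>a. {x. - a + x \<in> ?O}"] by blast
  obtain n :: nat and y where y: "A = y ` {i. i < n}"
    using A(2) unfolding finite_conv_nat_seg_image by blast
  show ?thesis
  proof (rule that[OF C])
    fix x assume "x \<in> K"
    then obtain i where i: "i < n" "\<phi> (- y i + x) > \<phi> 0 / 2" using A(3) y by auto
    have "\<phi> 0 / 2 \<le> \<phi> (- y i + x)" using i by simp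
    also have "\<dots> \<le> (\<Sum>l<n. \<phi> (- y l + x))"
      by (rule member_le_sum) (use i \<phi> in auto)
    finally have "C * (\<phi> 0 / 2) \<le> C * (\<Sum>l<n. \<phi> (- y l + x))" using C by simp
    then show "1 \<le> C * (\<Sum>l<n. \<phi> (- y l + x))" using \<phi>(3) by (simp add: C_def)
  qed
qed

text \<open>The dominating function does not depend on \<open>d\<close>.\<close>
lemma Cc_uniform_dominated_right:
  fixes \<phi> \<psi> :: "'a::{topological_group_add, t2_space} \<Rightarrow> real"
  assumes lc: "locally_compact_space (euclidean :: 'a topology)"
    and \<phi>: "\<phi> \<in> Cc" "\<And>x. 0 \<le> \<phi> x" "\<phi> 0 > 0" and \<psi>: "\<psi> \<in> Cc"
  obtains C :: real and m :: nat and z where "C > 0"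
    "\<And>d. d > 0 \<Longrightarrow> \<exists>U. open U \<and> 0 \<in> U \<and>
       (\<forall>v\<in>U. \<forall>x. \<bar>\<psi> (x + v) - \<psi> x\<bar> \<le> d * (C * (\<Sum>l<m. \<phi> (- z l + x))))"
proof -
  obtain K where K: "compact K" "\<And>x. x \<notin> K \<Longrightarrow> \<psi> x = 0" by (rule CcE[OF \<psi>]) (rule that)
  obtain W L :: "'a set" where WL: "open W" "compact L" "0 \<in> W" "W \<subseteq> L"
    by (rule compact_nbhd[OF lc]) (rule that)
  \<comment> \<open>Outside \<open>S\<close> both \<open>\<psi> x\<close> and
    \<open>\<psi> (x + v)\<close> vanish for all \<open>v \<in> W\<close>. As \<open>S\<close> is
    fixed before \<open>d\<close>, so are \<open>C\<close>, \<open>m\<close> and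
    \<open>z\<close>.\<close>
  define S where "S = (\<lambda>(x, y). x + y) ` (K \<times> uminus ` L) \<union> K"
  have S: "compact S"
    unfolding S_def
    by (intro compact_Un compact_plus_set K(1) compact_continuous_image[OF _ WL(2)] continuous_intros)
  obtain C :: real and m :: nat and z where
    C: "C > 0" "\<And>x. x \<in> S \<Longrightarrow> 1 \<le> C * (\<Sum>l<m. \<phi> (- z l + x))"
    by (rule Cc_dominated_cover[OF \<phi> S]) (rule that)
  have \<Phi>: "0 \<le> C * (\<Sum>l<m. \<phi> (- z l + x))" for x
    using C(1) \<phi>(2) by (intro mult_nonneg_nonneg sum_nonneg) auto
  show ?thesis
  proof (rule that[OF C(1)])
    fix d :: real assume d: "d > 0"
    obtain U where U: "open U" "0 \<in> U" "\<And>v x. v \<in> U \<Longrightarrow> \<bar>\<psi> (x + v) - \<psi> x\<bar> < d"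
      by (rule Cc_uniform_right[OF \<psi> d]) (rule that)
    have "\<bar>\<psi> (x + v) - \<psi> x\<bar> \<le> d * (C * (\<Sum>l<m. \<phi> (- z l + x)))" if v: "v \<in> U \<inter> W" for v x
    proof (cases "x \<in> S")
      case True
      have "\<bar>\<psi> (x + v) - \<psi> x\<bar> \<le> d * 1" using U(3)[of v x] v by simp
      also have "\<dots> \<le> d * (C * (\<Sum>l<m. \<phi> (- z l + x)))"
        using C(2)[OF True] d by (intro mult_left_mono) auto
      finally show ?thesis .
    next
      case False
      have "x + v \<notin> K"
      proof
        assume "x + v \<in> K"
        then have "(x + v) + - v \<in> S" unfolding S_def using v WL(4) by force
        then show False using False by (simp add: add.assoc)
      qed
      then show ?thesis using False K(2) d \<Phi>[of x] by (auto simp: S_def)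
    qed
    then show "\<exists>U. open U \<and> 0 \<in> U \<and>
       (\<forall>v\<in>U. \<forall>x. \<bar>\<psi> (x + v) - \<psi> x\<bar> \<le> d * (C * (\<Sum>l<m. \<phi> (- z l + x))))"
      using U(1,2) WL(1,3) by (intro exI[of _ "U \<inter> W"]) auto
  qed
qed

lemma Cc_uniform_dominated_left:
  fixes \<phi> \<psi> :: "'a::{topological_group_add, t2_space} \<Rightarrow> real"
  assumes lc: "locally_compact_space (euclidean :: 'a topology)"
    and \<phi>: "\<phi> \<in> Cc" "\<And>x. 0 \<le> \<phi> x" "\<phi> 0 > 0" and \<psi>: "\<psi> \<in> Cc"
  obtains C :: real and m :: nat and z where "C > 0"
    "\<And>d. d > 0 \<Longrightarrow> \<exists>U. open U \<and> 0 \<in> U \<and>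
       (\<forall>v\<in>U. \<forall>x. \<bar>\<psi> (v + x) - \<psi> x\<bar> \<le> d * (C * (\<Sum>l<m. \<phi> (- z l + x))))"
proof -
  obtain K where K: "compact K" "\<And>x. x \<notin> K \<Longrightarrow> \<psi> x = 0" by (rule CcE[OF \<psi>]) (rule that)
  obtain W L :: "'a set" where WL: "open W" "compact L" "0 \<in> W" "W \<subseteq> L"
    by (rule compact_nbhd[OF lc]) (rule that)
  define S where "S = (\<lambda>(x, y). x + y) ` (uminus ` L \<times> K) \<union> K"
  have S: "compact S"
    unfolding S_def
    by (intro compact_Un compact_plus_set K(1) compact_continuous_image[OF _ WL(2)] continuous_intros)
  obtain C :: real and m :: nat and z where
    C: "C > 0" "\<And>x. x \<in> S \<Longrightarrow> 1 \<le> C * (\<Sum>l<m. \<phi> (- z l + x))"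
    by (rule Cc_dominated_cover[OF \<phi> S]) (rule that)
  have \<Phi>: "0 \<le> C * (\<Sum>l<m. \<phi> (- z l + x))" for x
    using C(1) \<phi>(2) by (intro mult_nonneg_nonneg sum_nonneg) auto
  show ?thesis
  proof (rule that[OF C(1)])
    fix d :: real assume d: "d > 0"
    obtain U where U: "open U" "0 \<in> U" "\<And>v x. v \<in> U \<Longrightarrow> \<bar>\<psi> (v + x) - \<psi> x\<bar> < d"
      by (rule Cc_uniform_left[OF \<psi> d]) (rule that)
    have "\<bar>\<psi> (v + x) - \<psi> x\<bar> \<le> d * (C * (\<Sum>l<m. \<phi> (- z l + x)))" if v: "v \<in> U \<inter> W" for v x
    proof (cases "x \<in> S")
      case True
      have "\<bar>\<psi> (v + x) - \<psi> x\<bar> \<le> d * 1" using U(3)[of v x] v by simp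
      also have "\<dots> \<le> d * (C * (\<Sum>l<m. \<phi> (- z l + x)))"
        using C(2)[OF True] d by (intro mult_left_mono) auto
      finally show ?thesis .
    next
      case False
      have "v + x \<notin> K"
      proof
        assume "v + x \<in> K"
        then have "- v + (v + x) \<in> S" unfolding S_def using v WL(4) by force
        then show False using False by (simp add: add.assoc[symmetric])
      qed
      then show ?thesis using False K(2) d \<Phi>[of x] by (auto simp: S_def)
    qed
    then show "\<exists>U. open U \<and> 0 \<in> U \<and>
       (\<forall>v\<in>U. \<forall>x. \<bar>\<psi> (v + x) - \<psi> x\<bar> \<le> d * (C * (\<Sum>l<m. \<phi> (- z l + x))))"
      using U(1,2) WL(1,3) by (intro exI[of _ "U \<inter> W"]) auto
  qed
qed

section \<open>The Haar integral\<close>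

lemma abs_integral_bound:
  fixes f g :: "'a \<Rightarrow> real"
  assumes f: "integrable M f" and g: "integrable M g" and le: "\<And>x. \<bar>f x\<bar> \<le> g x"
  shows "\<bar>integral\<^sup>L M f\<bar> \<le> integral\<^sup>L M g"
proof -
  have "integral\<^sup>L M f \<le> integral\<^sup>L M g"
    by (rule Bochner_Integration.integral_mono[OF f g]) (use le in \<open>simp add: abs_le_iff\<close>)
  moreover have "integral\<^sup>L M (\<lambda>x. - f x) \<le> integral\<^sup>L M g"
    by (rule Bochner_Integration.integral_mono[OF _ g]) (use f le in \<open>simp_all add: abs_le_iff\<close>)
  ultimately show ?thesis by (simp add: abs_le_iff)
qed

locale haar_group =
  fixes M :: "'a::{topological_group_add, t2_space} measure"
  assumes haar: "left_haar_measure M"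
    and lc: "locally_compact_space (euclidean :: 'a topology)"
begin

lemma sets_M [simp, measurable_cong]: "sets M = sets borel"
  using haar by (simp add: left_haar_measure_def)

lemma space_M [simp]: "space M = UNIV"
  using sets_eq_imp_space_eq[OF sets_M] by simp

lemma borel_measurable_M [simp]: "borel_measurable M = borel_measurable borel"
  by (rule measurable_cong_sets) auto

lemma distr_left_translation: "distr M borel (\<lambda>x. g + x) = M"
proof (rule measure_eqI)
  have m: "(\<lambda>x. g + x) \<in> measurable M borel"
    by (subst borel_measurable_M) (intro borel_measurable_continuous_onI continuous_intros)
  fix A assume "A \<in> sets (distr M borel (\<lambda>x. g + x))"
  then have A: "A \<in> sets borel" by simp
  have "(\<lambda>x. g + x) -` A = (\<lambda>x. - g + x) ` A"
  proof (intro set_eqI iffI)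
    fix y assume "y \<in> (\<lambda>x. g + x) -` A"
    then have "- g + (g + y) \<in> (\<lambda>x. - g + x) ` A" by (intro imageI) simp
    then show "y \<in> (\<lambda>x. - g + x) ` A" by (simp add: add.assoc[symmetric])
  qed (auto simp: add.assoc[symmetric])
  then show "emeasure (distr M borel (\<lambda>x. g + x)) A = emeasure M A"
    using haar A by (simp add: emeasure_distr[OF m] left_haar_measure_def)
qed simp

lemma integral_left_translation:
  fixes f :: "'a \<Rightarrow> real"
  assumes "f \<in> borel_measurable borel"
  shows "integral\<^sup>L M (\<lambda>x. f (g + x)) = integral\<^sup>L M f"
proof -
  have m: "(\<lambda>x. g + x) \<in> measurable M borel"
    by (subst borel_measurable_M) (intro borel_measurable_continuous_onI continuous_intros)
  have "integral\<^sup>L M f = integral\<^sup>L (distr M borel (\<lambda>x. g + x)) f"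
    by (simp add: distr_left_translation)
  also have "\<dots> = integral\<^sup>L M (\<lambda>x. f (g + x))"
    by (rule integral_distr[OF m assms])
  finally show ?thesis ..
qed

lemma Cc_measurable: "\<phi> \<in> Cc \<Longrightarrow> \<phi> \<in> borel_measurable borel"
  by (intro borel_measurable_continuous_onI Cc_continuous)

lemma Cc_integrable_mult:
  fixes \<phi> h :: "'a \<Rightarrow> real"
  assumes \<phi>: "\<phi> \<in> Cc" and h: "h \<in> borel_measurable borel" "\<And>x. \<bar>h x\<bar> \<le> B"
  shows "integrable M (\<lambda>x. \<phi> x * h x)"
proof -
  obtain K where K: "compact K" "\<And>x. x \<notin> K \<Longrightarrow> \<phi> x = 0" using CcE[OF \<phi>] by blast
  obtain C where C: "C > 0" "\<And>x. \<bar>\<phi> x\<bar> \<le> C" using Cc_bounded[OF \<phi>] by blast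
  have KB: "K \<in> sets borel" using compact_imp_closed[OF K(1)] by simp
  show ?thesis
  proof (rule integrableI_bounded_set[where A = K and B = "C * B"])
    show "K \<in> sets M" using KB by simp
    show "(\<lambda>x. \<phi> x * h x) \<in> borel_measurable M"
      using Cc_measurable[OF \<phi>] h(1) by simp
    show "emeasure M K < \<infinity>" using haar K(1) by (simp add: left_haar_measure_def)
    have "\<bar>\<phi> x * h x\<bar> \<le> C * B" for x
      unfolding abs_mult using C h(2) by (intro mult_mono) (auto intro: less_imp_le)
    then show "AE x in M. x \<in> K \<longrightarrow> norm (\<phi> x * h x) \<le> C * B" by simp
    show "AE x in M. x \<notin> K \<longrightarrow> \<phi> x * h x = 0" using K(2) by simp
  qed
qed

lemma Cc_integrable: "\<phi> \<in> Cc \<Longrightarrow> integrable M \<phi>"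
  using Cc_integrable_mult[of \<phi> "\<lambda>_. 1" 1] by simp

text \<open>If \<open>U\<close> were null, so would be all its left translates. Finitely many of
  them cover any given compact set, so all compact sets would be null, and inner regularity would
  make the whole measure zero.\<close>

lemma measure_open_pos:
  assumes "open U" "U \<noteq> {}"
  shows "emeasure M U \<noteq> 0"
proof
  assume U0: "emeasure M U = 0"
  obtain a where a: "a \<in> U" using assms by blast
  \<comment> \<open>The left translate of \<open>U\<close> that carries \<open>a\<close> to
    \<open>b\<close>, so that \<open>b \<in> T b\<close>.\<close>
  define T where "T b = {x. (a + - b) + x \<in> U}" for b
  have Topen: "open (T b)" for b unfolding T_def by (rule open_left_translate[OF assms(1)])
  have T0: "T b \<in> null_sets M" for b
  proof -
    have UB: "U \<in> sets borel" using assms(1) by simp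
    have m: "(\<lambda>x. (a + - b) + x) \<in> measurable M borel"
      by (subst borel_measurable_M) (intro borel_measurable_continuous_onI continuous_intros)
    have "emeasure M U = emeasure (distr M borel (\<lambda>x. (a + - b) + x)) U"
      by (simp add: distr_left_translation)
    also have "\<dots> = emeasure M (T b)"
      by (subst emeasure_distr[OF m UB]) (simp add: T_def vimage_def)
    finally show ?thesis using U0 Topen[of b] by auto
  qed
  have "emeasure M K = 0" if K: "compact K" for K
  proof -
    have "K \<subseteq> (\<Union>b\<in>K. T b)" using a by (auto simp: T_def add.assoc)
    then obtain A where A: "A \<subseteq> K" "finite A" "K \<subseteq> (\<Union>b\<in>A. T b)"
      using compactE_image[OF K, of K T] Topen by blast
    have "(\<Union>b\<in>A. T b) \<in> null_sets M"
      using A(2) T0 by (intro null_sets_UN') (auto simp: countable_finite)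
    from null_sets_subset[OF this _ A(3)] compact_imp_closed[OF K] show ?thesis by auto
  qed
  moreover have "emeasure M UNIV = (SUP K\<in>{K. compact K \<and> K \<subseteq> UNIV}. emeasure M K)"
    using haar unfolding left_haar_measure_def by (metis sets.top space_borel)
  ultimately have "emeasure M UNIV = (SUP K\<in>{K :: 'a set. compact K}. 0)"
    by simp
  also have "\<dots> = 0" using compact_empty by (intro cSUP_const) blast
  finally have "emeasure M UNIV = 0" .
  then show False using haar by (simp add: left_haar_measure_def)
qed

lemma integral_Cc_pos:
  assumes \<phi>: "\<phi> \<in> Cc" "\<And>x. 0 \<le> \<phi> x" "\<phi> a > 0"
  shows "integral\<^sup>L M \<phi> > 0"
proof -
  have "integral\<^sup>L M \<phi> \<noteq> 0"
  proof
    assume "integral\<^sup>L M \<phi> = 0"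
    then have "AE x in M. \<phi> x = 0"
      using integral_nonneg_eq_0_iff_AE[OF Cc_integrable[OF \<phi>(1)]] \<phi>(2) by simp
    then have "{x. \<phi> x \<noteq> 0} \<in> null_sets M"
      using AE_iff_null_sets[of "{x. \<phi> x \<noteq> 0}" M] Cc_measurable[OF \<phi>(1)] by (auto simp: pred_def)
    moreover have "open {x. \<phi> x \<noteq> 0}"
      by (rule open_Collect_neq) (auto intro!: continuous_on_const Cc_continuous \<phi>)
    moreover have "a \<in> {x. \<phi> x \<noteq> 0}" using \<phi>(3) by simp
    ultimately show False using measure_open_pos by blast
  qed
  moreover have "integral\<^sup>L M \<phi> \<ge> 0" using \<phi>(2) by simp
  ultimately show ?thesis by simp
qed

text \<open>The error weights \<open>c\<close> are kept apart from the error bounds \<open>e\<close>, because \<open>e i\<close> will depend on a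
  further group variable through a translate of a fixed function.\<close>
lemma Riemann_sum:
  fixes w :: "'a \<Rightarrow> real" and U :: "'a \<Rightarrow> 'a set"
  assumes w: "w \<in> Cc" and K: "compact K" "\<And>x. x \<notin> K \<Longrightarrow> w x = 0"
    and U: "\<And>a. open (U a)" "\<And>a. a \<in> U a"
  obtains n :: nat and y b c where "\<And>i. i < n \<Longrightarrow> y i \<in> K" "\<And>i. 0 \<le> c i" "(\<Sum>i<n. b i) = integral\<^sup>L M w"
    "(\<Sum>i<n. c i) = integral\<^sup>L M (\<lambda>x. \<bar>w x\<bar>)"
    "\<forall>h e B. h \<in> borel_measurable borel \<longrightarrow> (\<forall>x. \<bar>h x\<bar> \<le> B) \<longrightarrow>
       (\<forall>i<n. \<forall>k\<in>U (y i). \<bar>h k - h (y i)\<bar> \<le> e i) \<longrightarrow>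
       \<bar>integral\<^sup>L M (\<lambda>x. w x * h x) - (\<Sum>i<n. b i * h (y i))\<bar> \<le> (\<Sum>i<n. c i * e i)"
proof -
  have "K \<subseteq> (\<Union>a\<in>K. U a)" using U by auto
  then obtain A where A: "A \<subseteq> K" "finite A" "K \<subseteq> (\<Union>a\<in>A. U a)"
    using compactE_image[OF K(1), of K U] U by blast
  obtain n :: nat and y where y: "A = y ` {i. i < n}"
    using A(2) unfolding finite_conv_nat_seg_image by blast
  \<comment> \<open>A disjoint refinement of the finite cover: on \<open>D i\<close> the integrand
    \<open>h\<close> stays within \<open>e i\<close> of its value at \<open>y i\<close>.\<close>
  define D where "D = disjointed (\<lambda>i. U (y i))"
  have DB: "D i \<in> sets borel" for i
    unfolding D_def disjointed_def using U(1) by auto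
  have DU: "D i \<subseteq> U (y i)" for i unfolding D_def by (rule disjointed_subset)
  have Ddis: "disjoint_family_on D {..<n}"
    using disjoint_family_disjointed[of "\<lambda>i. U (y i)"] unfolding D_def
    by (auto simp: disjoint_family_on_def)
  have DK: "K \<subseteq> (\<Union>i<n. D i)"
    unfolding D_def lessThan_atLeast0 finite_UN_disjointed_eq using A(3) y by force
  have split: "w x * g = (\<Sum>i<n. w x * indicat_real (D i) x * g)" for x g
  proof (cases "x \<in> K")
    case True
    then have "(\<Sum>i<n. indicat_real (D i) x) = 1"
      using indicator_UN_disjoint[OF _ Ddis, of x] DK
      by (metis finite_lessThan indicator_simps(1) subsetD)
    then show ?thesis by (simp add: sum_distrib_left[symmetric] sum_distrib_right[symmetric])
  qed (simp add: K(2))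
  have ind: "(\<lambda>x. indicat_real (D i) x * h x) \<in> borel_measurable borel"
    if "h \<in> borel_measurable borel" for i and h :: "'a \<Rightarrow> real"
    using that DB[of i] by simp
  have indb: "\<bar>indicat_real (D i) x * h x\<bar> \<le> B" if "\<And>x. \<bar>h x\<bar> \<le> B" for i x B and h :: "'a \<Rightarrow> real"
    using that[of x] by (auto simp: indicator_def)
  have int: "integrable M (\<lambda>x. u x * indicat_real (D i) x * h x)"
    if "u \<in> Cc" "h \<in> borel_measurable borel" "\<And>x. \<bar>h x\<bar> \<le> B" for i B and u h :: "'a \<Rightarrow> real"
    unfolding mult.assoc by (rule Cc_integrable_mult[OF that(1) ind[OF that(2)]]) (rule indb[OF that(3)])
  have int1: "integrable M (\<lambda>x. u x * indicat_real (D i) x)" if "u \<in> Cc" for i u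
    using int[OF that, of "\<lambda>_. 1" 1] by simp
  \<comment> \<open>The weights depend on \<open>w\<close> and the partition but not on
    \<open>h\<close>, so one choice serves a whole family of integrands. Their total is exactly the
    integral of \<open>w\<close>, which later preserves the condition that coefficients sum to
    zero.\<close>
  define b where "b i = integral\<^sup>L M (\<lambda>x. w x * indicat_real (D i) x)" for i
  define c where "c i = integral\<^sup>L M (\<lambda>x. \<bar>w x\<bar> * indicat_real (D i) x)" for i
  note wa = Cc_abs[OF w]
  show ?thesis
  proof (rule that[of n y c b])
    show "y i \<in> K" if "i < n" for i using A(1) y that by blast
    show "0 \<le> c i" for i unfolding c_def by (rule Bochner_Integration.integral_nonneg) simp
    have split1: "w x = (\<Sum>i<n. w x * indicat_real (D i) x)" for x
      using split[of x 1] by (simp only: mult_1_right)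
    have "(\<Sum>i<n. b i) = integral\<^sup>L M (\<lambda>x. \<Sum>i<n. w x * indicat_real (D i) x)"
      unfolding b_def by (rule Bochner_Integration.integral_sum[symmetric]) (rule int1[OF w])
    then show "(\<Sum>i<n. b i) = integral\<^sup>L M w"
      by (simp only: split1[symmetric])
    have abs_split: "\<bar>w x\<bar> = (\<Sum>i<n. \<bar>w x\<bar> * indicat_real (D i) x)" for x
    proof -
      have "\<bar>w x\<bar> = w x * sgn (w x)" by (simp add: abs_sgn)
      also have "\<dots> = (\<Sum>i<n. w x * indicat_real (D i) x * sgn (w x))" by (rule split)
      also have "\<dots> = (\<Sum>i<n. \<bar>w x\<bar> * indicat_real (D i) x)"
        by (intro sum.cong refl) (simp add: abs_sgn)
      finally show ?thesis .
    qed
    have "(\<Sum>i<n. c i) = integral\<^sup>L M (\<lambda>x. \<Sum>i<n. \<bar>w x\<bar> * indicat_real (D i) x)"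
      unfolding c_def by (rule Bochner_Integration.integral_sum[symmetric]) (rule int1[OF wa])
    then show "(\<Sum>i<n. c i) = integral\<^sup>L M (\<lambda>x. \<bar>w x\<bar>)"
      by (simp only: abs_split[symmetric])
    have "\<bar>integral\<^sup>L M (\<lambda>x. w x * h x) - (\<Sum>i<n. b i * h (y i))\<bar> \<le> (\<Sum>i<n. c i * e i)"
      if h: "h \<in> borel_measurable borel" "\<And>x. \<bar>h x\<bar> \<le> B"
      and e: "\<And>i k. i < n \<Longrightarrow> k \<in> U (y i) \<Longrightarrow> \<bar>h k - h (y i)\<bar> \<le> e i"
      for h :: "'a \<Rightarrow> real" and e :: "nat \<Rightarrow> real" and B :: real
    proof -
    have 1: "\<bar>integral\<^sup>L M (\<lambda>x. w x * indicat_real (D i) x * h x) - b i * h (y i)\<bar> \<le> c i * e i" if i: "i < n" for i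
    proof -
      have "integral\<^sup>L M (\<lambda>x. w x * indicat_real (D i) x * h x) - b i * h (y i)
          = integral\<^sup>L M (\<lambda>x. w x * indicat_real (D i) x * h x - w x * indicat_real (D i) x * h (y i))"
        unfolding b_def using int[OF w h] int1[OF w] by simp
      also have "\<bar>\<dots>\<bar> \<le> integral\<^sup>L M (\<lambda>x. \<bar>w x\<bar> * indicat_real (D i) x * e i)"
      proof (rule abs_integral_bound)
        fix x
        have "\<bar>w x * indicat_real (D i) x * h x - w x * indicat_real (D i) x * h (y i)\<bar>
          = \<bar>w x\<bar> * indicat_real (D i) x * \<bar>h x - h (y i)\<bar>"
          by (simp add: abs_mult right_diff_distrib[symmetric])
        also have "\<dots> \<le> \<bar>w x\<bar> * indicat_real (D i) x * e i"
          using e[OF i, of x] DU[of i] by (cases "x \<in> D i") (auto intro!: mult_left_mono)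
        finally show "\<bar>w x * indicat_real (D i) x * h x - w x * indicat_real (D i) x * h (y i)\<bar>
          \<le> \<bar>w x\<bar> * indicat_real (D i) x * e i" .
      qed (use int[OF w h] int1[OF w] int1[OF wa] in simp_all)
      also have "\<dots> = c i * e i" unfolding c_def by simp
      finally show ?thesis by simp
    qed
    have "integral\<^sup>L M (\<lambda>x. w x * h x) = integral\<^sup>L M (\<lambda>x. \<Sum>i<n. w x * indicat_real (D i) x * h x)"
      by (simp only: split[symmetric])
    also have "\<dots> = (\<Sum>i<n. integral\<^sup>L M (\<lambda>x. w x * indicat_real (D i) x * h x))"
      by (rule Bochner_Integration.integral_sum) (rule int[OF w h])
    finally have "integral\<^sup>L M (\<lambda>x. w x * h x) = (\<Sum>i<n. integral\<^sup>L M (\<lambda>x. w x * indicat_real (D i) x * h x))" .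
    then have "\<bar>integral\<^sup>L M (\<lambda>x. w x * h x) - (\<Sum>i<n. b i * h (y i))\<bar>
      = \<bar>\<Sum>i<n. integral\<^sup>L M (\<lambda>x. w x * indicat_real (D i) x * h x) - b i * h (y i)\<bar>"
      by (simp add: sum_subtractf)
    also have "\<dots> \<le> (\<Sum>i<n. c i * e i)"
      by (rule order_trans[OF sum_abs]) (use 1 in \<open>auto intro!: sum_mono\<close>)
    finally show ?thesis .
    qed
    then show "\<forall>h e B. h \<in> borel_measurable borel \<longrightarrow> (\<forall>x. \<bar>h x\<bar> \<le> B) \<longrightarrow>
       (\<forall>i<n. \<forall>k\<in>U (y i). \<bar>h k - h (y i)\<bar> \<le> e i) \<longrightarrow>
       \<bar>integral\<^sup>L M (\<lambda>x. w x * h x) - (\<Sum>i<n. b i * h (y i))\<bar> \<le> (\<Sum>i<n. c i * e i)"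
      by blast
  qed
qed

end

section \<open>Translate properties\<close>

lemma translate_property_topD:
  fixes n :: nat
  assumes tp: "translate_property E top" and f: "f \<in> E" "f a \<noteq> 0" "\<And>x. 0 \<le> f x"
    and "\<And>x. 0 \<le> (\<Sum>j<n. t j * f (- g j + x))"
  shows "0 \<le> (\<Sum>j<n. t j)"
proof (rule tp[unfolded translate_property_def eventually_top left_translate_def, rule_format, OF f(1)])
  show "\<not> (\<forall>x. f x = 0)" using f(2) by blast
qed (use assms in auto)

lemma translate_property_subset:
  "translate_property E F \<Longrightarrow> E' \<subseteq> E \<Longrightarrow> translate_property E' F"
  unfolding translate_property_def by blast

lemma left_quotient_translate: "- (a + y) + (a + x) = - y + (x :: 'a :: group_add)"
  by (simp only: minus_add add.assoc minus_add_cancel)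

text \<open>A relation rather than a function of \<open>u\<close>, because the same \<open>u\<close>
  may be represented with different totals \<open>c\<close>. It keeps track of the total without
  carrying the coefficients and group elements along.\<close>

definition translate_combination :: "('a::group_add \<Rightarrow> real) \<Rightarrow> ('a \<Rightarrow> real) \<Rightarrow> real \<Rightarrow> bool" where
  "translate_combination F u c \<longleftrightarrow>
     (\<exists>(n::nat) t g. u = (\<lambda>x. \<Sum>j<n. t j * F (- g j + x)) \<and> c = (\<Sum>j<n. t j))"

lemma translate_combinationI:
  "u = (\<lambda>x. \<Sum>j<n. t j * F (- g j + x)) \<Longrightarrow> c = (\<Sum>j<n. t j) \<Longrightarrow> translate_combination F u c"
  for n :: nat
  unfolding translate_combination_def by blast

lemma translate_combination_zero: "translate_combination F (\<lambda>x. 0) 0"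
  by (rule translate_combinationI[where n = 0]) auto

lemma translate_combination_snoc:
  assumes "translate_combination F u c"
  shows "translate_combination F (\<lambda>x. u x + s * F (- a + x)) (c + s)"
proof -
  obtain n :: nat and t g where ng: "u = (\<lambda>x. \<Sum>j<n. t j * F (- g j + x))" "c = (\<Sum>j<n. t j)"
    using assms unfolding translate_combination_def by blast
  show ?thesis
    by (rule translate_combinationI[where n = "Suc n" and t = "t(n := s)" and g = "g(n := a)"])
      (simp_all add: ng)
qed

lemma translate_combination_add:
  assumes u: "translate_combination F u c" and v: "translate_combination F v d"
  shows "translate_combination F (\<lambda>x. u x + v x) (c + d)"
proof -
  obtain n :: nat and t g where ng: "v = (\<lambda>x. \<Sum>j<n. t j * F (- g j + x))" "d = (\<Sum>j<n. t j)"
    using v unfolding translate_combination_def by blast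
  have "translate_combination F (\<lambda>x. u x + (\<Sum>j<m. t j * F (- g j + x))) (c + (\<Sum>j<m. t j))" for m :: nat
  proof (induction m)
    case 0 then show ?case using u by simp
  next
    case (Suc m)
    from translate_combination_snoc[OF this, of "t m" "g m"] show ?case by (simp add: add.assoc)
  qed
  then show ?thesis unfolding ng by blast
qed

lemma translate_combination_translate: "translate_combination F (\<lambda>x. F (a + x)) 1"
  using translate_combination_snoc[OF translate_combination_zero, of F 1 "- a"] by simp

lemma translate_combination_self: "translate_combination F F 1"
  using translate_combination_translate[of F 0] by simp

lemma translate_combination_cmult:
  assumes "translate_combination F u c"
  shows "translate_combination F (\<lambda>x. s * u x) (s * c)"
proof -
  obtain n :: nat and t g where ng: "u = (\<lambda>x. \<Sum>j<n. t j * F (- g j + x))" "c = (\<Sum>j<n. t j)"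
    using assms unfolding translate_combination_def by blast
  show ?thesis
    by (rule translate_combinationI[where n = n and t = "\<lambda>j. s * t j" and g = g])
      (simp_all add: ng sum_distrib_left mult.assoc)
qed

lemma translate_combination_left:
  assumes "translate_combination F u c"
  shows "translate_combination F (\<lambda>x. u (a + x)) c"
proof -
  obtain n :: nat and t g where ng: "u = (\<lambda>x. \<Sum>j<n. t j * F (- g j + x))" "c = (\<Sum>j<n. t j)"
    using assms unfolding translate_combination_def by blast
  show ?thesis
    by (rule translate_combinationI[where n = n and t = t and g = "\<lambda>j. - a + g j"])
      (simp_all add: ng minus_add add.assoc)
qed

lemma translate_combination_sum:
  assumes "finite I" "\<And>i. i \<in> I \<Longrightarrow> translate_combination F (u i) (c i)"
  shows "translate_combination F (\<lambda>x. \<Sum>i\<in>I. u i x) (\<Sum>i\<in>I. c i)"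
  using assms
  by (induction I rule: finite_induct)
    (auto intro: translate_combination_zero translate_combination_add)

lemma translate_combination_nonneg:
  assumes "translate_property E top" "F \<in> E" "\<And>x. 0 \<le> F x" "F a \<noteq> 0"
    and "translate_combination F u c" "\<And>x. 0 \<le> u x"
  shows "0 \<le> c"
proof -
  obtain n :: nat and t g where ng: "u = (\<lambda>x. \<Sum>j<n. t j * F (- g j + x))" "c = (\<Sum>j<n. t j)"
    using assms(5) unfolding translate_combination_def by blast
  have "0 \<le> (\<Sum>j<n. t j)"
    by (rule translate_property_topD[OF assms(1,2,4,3), where g = g]) (use assms(6) ng(1) in simp)
  then show ?thesis using ng(2) by simp
qed

section \<open>Passing between measurable and continuous functions\<close>

context haar_group
begin

lemma bump_UNIV:
  obtains \<phi> :: "'a \<Rightarrow> real" where "\<phi> \<in> Cc" "\<And>x. 0 \<le> \<phi> x" "\<phi> 0 = 1"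
  by (rule bump_exists[OF lc open_UNIV UNIV_I]) (rule that, assumption+)

text \<open>Beyond the inclusion, the point is that a non-zero continuous function stays non-zero as
  a class modulo null sets, because nonempty open sets have positive measure.\<close>

lemma translate_property_Linf_imp_Cb:
  assumes tp: "translate_property Linf_fun (ae_filter M)"
  shows "translate_property (Cb :: ('a \<Rightarrow> real) set) top"
  unfolding translate_property_def eventually_top left_translate_def
proof (intro ballI allI impI)
  fix f :: "'a \<Rightarrow> real" and n :: nat and t g
  assume f: "f \<in> Cb" "\<not> (\<forall>x. f x = 0)" "\<forall>x. 0 \<le> f x" "\<forall>x. 0 \<le> (\<Sum>j<n. t j * f (- g j + x))"
  obtain a where a: "f a \<noteq> 0" using f(2) by blast
  have fc: "continuous_on UNIV f" "bounded (range f)" using f(1) by (auto simp: bcontfun_def)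
  then have fL: "f \<in> Linf_fun"
    unfolding Linf_fun_def using borel_measurable_continuous_onI by blast
  have nz: "\<not> (AE x in M. f x = 0)"
  proof
    assume "AE x in M. f x = 0"
    then have "{x. f x \<noteq> 0} \<in> null_sets M"
      using AE_iff_null_sets[of "{x. f x \<noteq> 0}" M] fL by (auto simp: pred_def Linf_fun_def)
    moreover have "open {x. f x \<noteq> 0}"
      by (rule open_Collect_neq) (auto intro!: continuous_on_const fc)
    moreover have "a \<in> {x. f x \<noteq> 0}" using a by simp
    ultimately show False using measure_open_pos by blast
  qed
  have "AE x in M. 0 \<le> f x" using f(3) by simp
  moreover have "AE x in M. 0 \<le> (\<Sum>j<n. t j * left_translate (g j) f x)"
    using f(4) by (simp add: left_translate_def)
  ultimately show "0 \<le> (\<Sum>j<n. t j)"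
    by (intro tp[unfolded translate_property_def, rule_format, OF fL nz])
qed

text \<open>Right convolution with \<open>\<phi>\<close> commutes with left translations and maps \<open>L\<^sup>\<infinity>\<close>
  into the left uniformly continuous functions.\<close>
lemma translate_property_Cb_lu_imp_Linf:
  assumes tp: "translate_property (Cb_lu :: ('a \<Rightarrow> real) set) top"
  shows "translate_property Linf_fun (ae_filter M)"
  unfolding translate_property_def
proof (intro ballI allI impI)
  fix f :: "'a \<Rightarrow> real" and n :: nat and t g
  assume f: "f \<in> Linf_fun" "\<not> (AE x in M. f x = 0)" "AE x in M. 0 \<le> f x"
    and sum: "AE x in M. 0 \<le> (\<Sum>j<n. t j * left_translate (g j) f x)"
  have fm: "f \<in> borel_measurable borel" and "bounded (range f)" using f(1) by (auto simp: Linf_fun_def)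
  then obtain B where B: "B > 0" "\<And>x. \<bar>f x\<bar> \<le> B" by (auto simp: bounded_pos)
  obtain \<phi> :: "'a \<Rightarrow> real" where \<phi>: "\<phi> \<in> Cc" "\<And>x. 0 \<le> \<phi> x" "\<phi> 0 = 1"
    by (rule bump_UNIV) (rule that)
  have \<phi>0: "\<phi> 0 > 0" using \<phi>(3) by simp
  have fml: "(\<lambda>y. f (a + y)) \<in> borel_measurable borel" for a
  proof -
    have "(\<lambda>y. a + y) \<in> borel_measurable borel"
      by (intro borel_measurable_continuous_onI continuous_intros)
    from measurable_compose[OF this fm] show ?thesis .
  qed
  have \<phi>r: "(\<lambda>y. \<phi> (- y + x)) \<in> Cc" for x by (rule Cc_reflect[OF \<phi>(1)])
  have int: "integrable M (\<lambda>y. \<phi> (- y + x) * f (a + y))" for x a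
    by (rule Cc_integrable_mult[OF \<phi>r fml]) (rule B(2))
  define F where "F x = integral\<^sup>L M (\<lambda>y. \<phi> (- y + x) * f y)" for x
  have F_left: "F (a + x) = integral\<^sup>L M (\<lambda>y. \<phi> (- y + x) * f (a + y))" for a x
  proof -
    have "(\<lambda>y. \<phi> (- y + (a + x)) * f y) \<in> borel_measurable borel"
      using Cc_measurable[OF \<phi>r] fm by simp
    from integral_left_translation[OF this, of a] show ?thesis
      by (simp only: F_def left_quotient_translate)
  qed
  define J where "J = integral\<^sup>L M (\<lambda>y. \<bar>\<phi> (- y)\<bar>)"
  have unif: "\<exists>U. open U \<and> 0 \<in> U \<and> (\<forall>v\<in>U. \<forall>x. \<bar>F (x + v) - F x\<bar> \<le> e)" if e: "e > 0" for e
  proof -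
    obtain C :: real and m :: nat and z where C: "C > 0"
      "\<And>d. d > 0 \<Longrightarrow> \<exists>U. open U \<and> 0 \<in> U \<and>
         (\<forall>v\<in>U. \<forall>x. \<bar>\<phi> (x + v) - \<phi> x\<bar> \<le> d * (C * (\<Sum>l<m. \<phi> (- z l + x))))"
      by (rule Cc_uniform_dominated_right[OF lc \<phi>(1,2) \<phi>0 \<phi>(1)]) (rule that)
    define \<Phi> where "\<Phi> x = C * (\<Sum>l<m. \<phi> (- z l + x))" for x
    have \<Phi>: "\<Phi> \<in> Cc" "\<And>x. 0 \<le> \<Phi> x" unfolding \<Phi>_def
      using C(1) \<phi>(2) by (auto intro!: Cc_cmult Cc_sum Cc_left \<phi>(1) sum_nonneg mult_nonneg_nonneg)
    define A where "A = integral\<^sup>L M (\<lambda>y. \<Phi> (- y))"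
    have A: "A \<ge> 0" unfolding A_def using \<Phi>(2) by simp
    \<comment> \<open>The increment of \<open>F\<close> will be at most \<open>d * B * A\<close>,
      which this choice keeps below \<open>e\<close>; the added 1 allows for
      \<open>A = 0\<close>.\<close>
    define d where "d = e / (B * (A + 1))"
    have d: "d > 0" using e B(1) A by (simp add: d_def)
    obtain U where U: "open U" "0 \<in> U" "\<And>v x. v \<in> U \<Longrightarrow> \<bar>\<phi> (x + v) - \<phi> x\<bar> \<le> d * \<Phi> x"
      using C(2)[OF d] unfolding \<Phi>_def by blast
    have "\<bar>F (x + v) - F x\<bar> \<le> e" if v: "v \<in> U" for v x
    proof -
      have fx: "\<bar>f (x + y)\<bar> \<le> B" for y by (rule B(2))
      have 1: "integrable M (\<lambda>y. \<phi> (- y + v) * f (x + y))" "integrable M (\<lambda>y. \<phi> (- y) * f (x + y))"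
        using int[of v x] int[of 0 x] by simp_all
      have "F (x + v) - F x = integral\<^sup>L M (\<lambda>y. \<phi> (- y + v) * f (x + y) - \<phi> (- y) * f (x + y))"
        using F_left[of x v] F_left[of x 0] 1 by simp
      also have "\<bar>\<dots>\<bar> \<le> integral\<^sup>L M (\<lambda>y. d * B * \<Phi> (- y))"
      proof (rule abs_integral_bound)
        fix y
        have "\<bar>\<phi> (- y + v) * f (x + y) - \<phi> (- y) * f (x + y)\<bar> = \<bar>\<phi> (- y + v) - \<phi> (- y)\<bar> * \<bar>f (x + y)\<bar>"
          by (simp add: abs_mult[symmetric] left_diff_distrib)
        also have "\<dots> \<le> (d * \<Phi> (- y)) * B"
          using U(3)[OF v, of "- y"] fx d \<Phi>(2) by (intro mult_mono) auto
        finally show "\<bar>\<phi> (- y + v) * f (x + y) - \<phi> (- y) * f (x + y)\<bar> \<le> d * B * \<Phi> (- y)"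
          by (simp add: mult_ac)
      qed (use 1 Cc_integrable[OF Cc_uminus[OF \<Phi>(1)]] in auto)
      also have "\<dots> = d * B * A" by (simp add: A_def)
      also have "\<dots> \<le> e"
      proof -
        have "d * B * A = e * (A / (A + 1))" using B(1) by (simp add: d_def)
        also have "\<dots> \<le> e * 1" using e A by (intro mult_left_mono) auto
        finally show ?thesis by simp
      qed
      finally show ?thesis .
    qed
    then show ?thesis using U(1,2) by blast
  qed
  have Fb: "\<bar>F x\<bar> \<le> B * J" for x
  proof -
    have "F x = integral\<^sup>L M (\<lambda>y. \<phi> (- y) * f (x + y))" using F_left[of x 0] by simp
    also have "\<bar>\<dots>\<bar> \<le> integral\<^sup>L M (\<lambda>y. B * \<bar>\<phi> (- y)\<bar>)"
      by (rule abs_integral_bound)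
        (use int[of 0 x] Cc_integrable[OF Cc_abs[OF Cc_uminus[OF \<phi>(1)]]] B in
          \<open>auto simp: abs_mult mult.commute[of B] intro!: mult_left_mono\<close>)
    finally show ?thesis by (simp add: J_def)
  qed
  have "F \<in> Cb_lu"
    by (rule Cb_luI[OF bcontfunI_bound[OF continuous_on_uniform_right[OF unif] Fb] unif])
  moreover have "\<exists>a. F a \<noteq> 0"
  proof (rule ccontr)
    assume "\<nexists>a. F a \<noteq> 0"
    then have F0: "F x = 0" for x by simp
    have "AE y in M. \<phi> (- y + x) * f y = 0" for x
    proof -
      have "AE y in M. 0 \<le> \<phi> (- y + x) * f y" using f(3) by eventually_elim (use \<phi>(2) in auto)
      from integral_nonneg_eq_0_iff_AE[OF _ this] show ?thesis using F0[of x] int[of x 0] by (simp add: F_def)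
    qed
    then have *: "{y. \<phi> (- y + x) * f y \<noteq> 0} \<in> null_sets M" for x
      using AE_iff_null_sets[of "{y. \<phi> (- y + x) * f y \<noteq> 0}" M] Cc_measurable[OF \<phi>r] fm by auto
    have nB: "{y. f y \<noteq> 0} \<in> sets borel" using fm by simp
    \<comment> \<open>By \<open>*\<close>, \<open>f\<close> vanishes almost everywhere on the
      neighbourhood of \<open>x\<close> where \<open>\<phi> (- y + x) \<noteq> 0\<close>. Finitely
      many of these cover \<open>K\<close>, and on \<open>K\<close> the function \<open>f\<close>
      has no zero. Inner regularity then passes from compact subsets to the whole set where
      \<open>f\<close> is non-zero.\<close>
    have K0: "emeasure M K = 0" if K: "compact K" "K \<subseteq> {y. f y \<noteq> 0}" for K
    proof -
      have "open {y. \<phi> (- y + x) \<noteq> 0}" for x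
        by (rule open_Collect_neq) (auto intro!: continuous_on_const Cc_continuous \<phi>r)
      moreover have "K \<subseteq> (\<Union>x\<in>K. {y. \<phi> (- y + x) \<noteq> 0})" using \<phi>(3) by force
      ultimately obtain A where A: "A \<subseteq> K" "finite A" "K \<subseteq> (\<Union>x\<in>A. {y. \<phi> (- y + x) \<noteq> 0})"
        using compactE_image[OF K(1), of K "\<lambda>x. {y. \<phi> (- y + x) \<noteq> 0}"] by blast
      have N: "(\<Union>x\<in>A. {y. \<phi> (- y + x) * f y \<noteq> 0}) \<in> null_sets M"
        using A(2) * by (intro null_sets_UN') (auto simp: countable_finite)
      have KN: "K \<subseteq> (\<Union>x\<in>A. {y. \<phi> (- y + x) * f y \<noteq> 0})" using A(3) K(2) by auto
      have "K \<in> sets M" using compact_imp_closed[OF K(1)] by simp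
      from null_sets_subset[OF N this KN] have "K \<in> null_sets M" .
      then show ?thesis by blast
    qed
    have "emeasure M {y. f y \<noteq> 0} = (SUP K\<in>{K. compact K \<and> K \<subseteq> {y. f y \<noteq> 0}}. emeasure M K)"
      using haar nB unfolding left_haar_measure_def by blast
    also have "\<dots> = (SUP K\<in>{K. compact K \<and> K \<subseteq> {y. f y \<noteq> 0}}. 0)"
      by (rule SUP_cong) (use K0 in auto)
    also have "\<dots> = 0" using compact_empty by (intro cSUP_const) blast
    finally have "{x. f x \<noteq> 0} \<in> null_sets M" using nB by auto
    then have "AE x in M. f x = 0"
      using AE_iff_null_sets[of "{x. f x \<noteq> 0}" M] nB by auto
    then show False using f(2) by blast
  qed
  then obtain a where "F a \<noteq> 0" by blast
  ultimately show "0 \<le> (\<Sum>j<n. t j)"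
  proof (rule translate_property_topD[OF tp])
    show "0 \<le> F x" for x
      unfolding F_def
      by (rule integral_nonneg_AE) (use f(3) \<phi>(2) in \<open>auto elim: eventually_mono\<close>)
    show "0 \<le> (\<Sum>j<n. t j * F (- g j + x))" for x
    proof -
      have "(\<Sum>j<n. t j * F (- g j + x))
          = (\<Sum>j<n. integral\<^sup>L M (\<lambda>y. t j * (\<phi> (- y + x) * f (- g j + y))))"
        unfolding F_left by simp
      also have "\<dots> = integral\<^sup>L M (\<lambda>y. \<Sum>j<n. t j * (\<phi> (- y + x) * f (- g j + y)))"
        by (rule Bochner_Integration.integral_sum[symmetric]) (rule integrable_mult_right[OF int])
      also have "\<dots> \<ge> 0"
      proof (rule integral_nonneg_AE)
        show "AE y in M. 0 \<le> (\<Sum>j<n. t j * (\<phi> (- y + x) * f (- g j + y)))"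
          using sum
        proof eventually_elim
          case (elim y)
          have "(\<Sum>j<n. t j * (\<phi> (- y + x) * f (- g j + y)))
             = \<phi> (- y + x) * (\<Sum>j<n. t j * left_translate (g j) f y)"
            by (simp add: sum_distrib_left left_translate_def mult_ac)
          then show ?case using elim \<phi>(2) by simp
        qed
      qed
      finally show ?thesis .
    qed
  qed
qed

end

section \<open>Approximation by translates of a bump function\<close>

context haar_group
begin

text \<open>A Riemann sum for the convolution of \<open>\<kappa>\<close> with a bump function \<open>\<psi>\<close> of small support.\<close>
lemma approx_by_translates:
  assumes \<kappa>: "\<kappa> \<in> Cc" "integral\<^sup>L M \<kappa> = 0"
    and \<phi>: "\<phi> \<in> Cc" "\<And>x. 0 \<le> \<phi> x" "\<phi> 0 > 0"
  obtains C :: real and m :: nat and z where "C > 0"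
    "\<And>\<epsilon>. \<epsilon> > 0 \<Longrightarrow> \<exists>\<psi> (n::nat) b y. \<psi> \<in> Cc \<and> (\<forall>x. 0 \<le> \<psi> x) \<and> (\<Sum>i<n. b i) = 0 \<and>
       (\<forall>x. \<bar>\<kappa> x - (\<Sum>i<n. b i * \<psi> (- y i + x))\<bar> \<le> \<epsilon> * (C * (\<Sum>l<m. \<phi> (- z l + x))))"
proof -
  obtain K where K: "compact K" "\<And>x. x \<notin> K \<Longrightarrow> \<kappa> x = 0" by (rule CcE[OF \<kappa>(1)]) (rule that)
  obtain W L :: "'a set" where WL: "open W" "compact L" "0 \<in> W" "W \<subseteq> L"
    by (rule compact_nbhd[OF lc]) (rule that)
  \<comment> \<open>Outside \<open>S\<close> the function \<open>\<kappa>\<close> vanishes, and so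
    do the translates of \<open>\<psi>\<close> by points of \<open>K\<close> once
    \<open>\<psi>\<close> is supported in \<open>W\<close>. A uniform error on \<open>S\<close> is
    then enough for the dominated one.\<close>
  define S where "S = (\<lambda>(x, y). x + y) ` (K \<times> L)"
  have S: "compact S" unfolding S_def by (intro compact_plus_set K(1) WL(2))
  have KS: "K \<subseteq> S" unfolding S_def using WL(3,4) by force
  obtain C :: real and m :: nat and z where
    C: "C > 0" "\<And>x. x \<in> S \<Longrightarrow> 1 \<le> C * (\<Sum>l<m. \<phi> (- z l + x))"
    by (rule Cc_dominated_cover[OF \<phi> S]) (rule that)
  have \<Phi>: "0 \<le> C * (\<Sum>l<m. \<phi> (- z l + x))" for x
    using C(1) \<phi>(2) by (intro mult_nonneg_nonneg sum_nonneg) auto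
  show ?thesis
  proof (rule that[OF C(1)])
    fix \<epsilon> :: real assume "\<epsilon> > 0"
    then have e: "\<epsilon> / 2 > 0" by simp
    obtain U1 where U1: "open U1" "0 \<in> U1" "\<And>v x. v \<in> U1 \<Longrightarrow> \<bar>\<kappa> (x + v) - \<kappa> x\<bar> < \<epsilon> / 2"
      by (rule Cc_uniform_right[OF \<kappa>(1) e]) (rule that)
    \<comment> \<open>If \<open>\<psi> (- k + x) \<noteq> 0\<close>, then \<open>- x + k\<close>
      must lie in \<open>U1\<close> to compare \<open>\<kappa> k\<close> with
      \<open>\<kappa> x\<close>; hence the inverse of \<open>U1\<close>.\<close>
    have V: "open (W \<inter> {x. - x \<in> U1})" "0 \<in> W \<inter> {x. - x \<in> U1}"
      using WL(1,3) U1(2) open_uminus[OF U1(1)] by auto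
    obtain \<psi> :: "'a \<Rightarrow> real" where \<psi>: "\<psi> \<in> Cc" "\<And>x. 0 \<le> \<psi> x" "\<And>x. \<psi> x \<le> 1" "\<psi> 0 = 1"
      "\<And>x. x \<notin> W \<inter> {x. - x \<in> U1} \<Longrightarrow> \<psi> x = 0"
      by (rule bump_exists[OF lc V]) (rule that)
    \<comment> \<open>By left invariance this is also the integral of
      \<open>\<psi> (- k + x)\<close> over \<open>k\<close> for every \<open>x\<close>, so dividing
      by \<open>c\<close> normalises the smoothing kernel.\<close>
    define c where "c = integral\<^sup>L M (\<lambda>k. \<psi> (- k))"
    have c: "c > 0"
      unfolding c_def by (rule integral_Cc_pos[of _ 0]) (use \<psi> Cc_uminus in auto)
    define A where "A = integral\<^sup>L M (\<lambda>x. \<bar>\<kappa> x\<bar>)"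
    have A: "A \<ge> 0" unfolding A_def by simp
    \<comment> \<open>The error has two halves, each at most \<open>\<epsilon> / 2 * c\<close>
      before division by \<open>c\<close>: the Riemann sum, controlled by this tolerance, and the
      smoothing of \<open>\<kappa>\<close> by \<open>\<psi>\<close>.\<close>
    have "\<epsilon> / 2 * c / (A + 1) > 0" using e c A by simp
    then obtain U2 where U2: "open U2" "0 \<in> U2"
      "\<And>v x. v \<in> U2 \<Longrightarrow> \<bar>\<psi> (v + x) - \<psi> x\<bar> < \<epsilon> / 2 * c / (A + 1)"
      by (rule Cc_uniform_left[OF \<psi>(1)]) (rule that)
    have fam: "open {k. - k + a \<in> U2}" "a \<in> {k. - k + a \<in> U2}" for a
      using open_uminus[OF open_right_translate[OF U2(1)]] U2(2) by auto
    obtain n :: nat and y b cc where R: "\<And>i. i < n \<Longrightarrow> y i \<in> K" "\<And>i. 0 \<le> cc i"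
      "(\<Sum>i<n. b i) = integral\<^sup>L M \<kappa>" "(\<Sum>i<n. cc i) = integral\<^sup>L M (\<lambda>x. \<bar>\<kappa> x\<bar>)"
      "\<forall>h e B. h \<in> borel_measurable borel \<longrightarrow> (\<forall>x. \<bar>h x\<bar> \<le> B) \<longrightarrow>
       (\<forall>i<n. \<forall>k\<in>{k. - k + y i \<in> U2}. \<bar>h k - h (y i)\<bar> \<le> e i) \<longrightarrow>
       \<bar>integral\<^sup>L M (\<lambda>x. \<kappa> x * h x) - (\<Sum>i<n. b i * h (y i))\<bar> \<le> (\<Sum>i<n. cc i * e i)"
      by (rule Riemann_sum[where U = "\<lambda>a. {k. - k + a \<in> U2}", OF \<kappa>(1) K(1) _ fam])
        (rule K(2), assumption, rule that)
    have \<psi>r: "(\<lambda>k. \<psi> (- k + x)) \<in> Cc" for x by (rule Cc_reflect[OF \<psi>(1)])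
    have \<psi>int: "integral\<^sup>L M (\<lambda>k. \<psi> (- k + x)) = c" for x
      using integral_left_translation[OF Cc_measurable[OF \<psi>r[of x]], of x]
        left_quotient_translate[of x _ 0] by (simp add: c_def)
    have near: "\<bar>c * \<kappa> x - (\<Sum>i<n. b i * \<psi> (- y i + x))\<bar> \<le> \<epsilon> * c" for x
    proof -
      have 1: "\<bar>integral\<^sup>L M (\<lambda>k. \<kappa> k * \<psi> (- k + x)) - (\<Sum>i<n. b i * \<psi> (- y i + x))\<bar>
          \<le> (\<Sum>i<n. cc i * (\<epsilon> / 2 * c / (A + 1)))"
      proof (rule R(5)[rule_format, where B = 1])
        show "(\<lambda>k. \<psi> (- k + x)) \<in> borel_measurable borel" by (rule Cc_measurable[OF \<psi>r])
        show "\<bar>\<psi> (- k + x)\<bar> \<le> 1" for k using \<psi>(2,3) by simp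
        fix i k assume "k \<in> {k. - k + y i \<in> U2}"
        then show "\<bar>\<psi> (- k + x) - \<psi> (- y i + x)\<bar> \<le> \<epsilon> / 2 * c / (A + 1)"
          using U2(3)[of "- k + y i" "- y i + x"] by (simp add: add.assoc)
      qed
      also have "\<dots> = \<epsilon> / 2 * c * (A / (A + 1))"
        unfolding sum_distrib_right[symmetric] R(4) A_def[symmetric] by simp
      also have "\<dots> \<le> \<epsilon> / 2 * c * 1" using e c A by (intro mult_left_mono) auto
      finally have 1: "\<bar>integral\<^sup>L M (\<lambda>k. \<kappa> k * \<psi> (- k + x)) - (\<Sum>i<n. b i * \<psi> (- y i + x))\<bar> \<le> \<epsilon> / 2 * c"
        by simp
      have ik: "integrable M (\<lambda>k. \<kappa> k * \<psi> (- k + x))" by (rule Cc_integrable[OF Cc_mult[OF \<kappa>(1) \<psi>r]])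
      have i\<psi>: "integrable M (\<lambda>k. \<psi> (- k + x))" by (rule Cc_integrable[OF \<psi>r])
      have "c * \<kappa> x - integral\<^sup>L M (\<lambda>k. \<kappa> k * \<psi> (- k + x))
          = integral\<^sup>L M (\<lambda>k. \<psi> (- k + x) * \<kappa> x - \<kappa> k * \<psi> (- k + x))"
        using ik i\<psi> \<psi>int[of x] by simp
      also have "\<bar>\<dots>\<bar> \<le> integral\<^sup>L M (\<lambda>k. \<epsilon> / 2 * \<psi> (- k + x))"
      proof (rule abs_integral_bound)
        fix k
        have "\<psi> (- k + x) * \<kappa> x - \<kappa> k * \<psi> (- k + x) = \<psi> (- k + x) * (\<kappa> x - \<kappa> k)"
          by (simp add: algebra_simps)
        then have "\<bar>\<psi> (- k + x) * \<kappa> x - \<kappa> k * \<psi> (- k + x)\<bar> = \<psi> (- k + x) * \<bar>\<kappa> x - \<kappa> k\<bar>"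
          using \<psi>(2)[of "- k + x"] by (simp add: abs_mult)
        also have "\<dots> \<le> \<psi> (- k + x) * (\<epsilon> / 2)"
        proof (cases "- k + x \<in> W \<inter> {x. - x \<in> U1}")
          case True
          then have "- x + k \<in> U1" by (simp add: minus_add)
          from U1(3)[OF this, of x] have "\<bar>\<kappa> x - \<kappa> k\<bar> \<le> \<epsilon> / 2"
            by (simp add: add.assoc[symmetric] abs_minus_commute)
          then show ?thesis by (intro mult_left_mono \<psi>(2))
        qed (simp add: \<psi>(5))
        finally show "\<bar>\<psi> (- k + x) * \<kappa> x - \<kappa> k * \<psi> (- k + x)\<bar> \<le> \<epsilon> / 2 * \<psi> (- k + x)"
          by (simp add: mult.commute)
      qed (use ik i\<psi> in simp_all)
      also have "\<dots> = \<epsilon> / 2 * c" using \<psi>int[of x] by simp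
      finally show ?thesis using 1 by linarith
    qed
    have zero: "\<kappa> x - (\<Sum>i<n. b i / c * \<psi> (- y i + x)) = 0" if x: "x \<notin> S" for x
    proof -
      have "\<psi> (- y i + x) = 0" if "i < n" for i
      proof (rule \<psi>(5), rule notI)
        assume "- y i + x \<in> W \<inter> {x. - x \<in> U1}"
        then have "y i + (- y i + x) \<in> S" using R(1)[OF that] WL(4) unfolding S_def by force
        then show False using x by (simp add: add.assoc[symmetric])
      qed
      moreover have "\<kappa> x = 0" using x KS K(2) by blast
      ultimately show ?thesis by simp
    qed
    have main: "\<bar>\<kappa> x - (\<Sum>i<n. b i / c * \<psi> (- y i + x))\<bar> \<le> \<epsilon> * (C * (\<Sum>l<m. \<phi> (- z l + x)))" for x
    proof (cases "x \<in> S")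
      case True
      have "c * (\<kappa> x - (\<Sum>i<n. b i / c * \<psi> (- y i + x))) = c * \<kappa> x - (\<Sum>i<n. b i * \<psi> (- y i + x))"
        using c by (simp add: right_diff_distrib sum_distrib_left)
      moreover have "c * \<bar>\<kappa> x - (\<Sum>i<n. b i / c * \<psi> (- y i + x))\<bar>
          = \<bar>c * (\<kappa> x - (\<Sum>i<n. b i / c * \<psi> (- y i + x)))\<bar>"
        unfolding abs_mult using c by simp
      ultimately have "c * \<bar>\<kappa> x - (\<Sum>i<n. b i / c * \<psi> (- y i + x))\<bar> \<le> c * \<epsilon>"
        using near[of x] by (simp only: mult.commute[of c \<epsilon>])
      then have "\<bar>\<kappa> x - (\<Sum>i<n. b i / c * \<psi> (- y i + x))\<bar> \<le> \<epsilon> * 1" using c by simp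
      also have "\<dots> \<le> \<epsilon> * (C * (\<Sum>l<m. \<phi> (- z l + x)))"
        using C(2)[OF True] e by (intro mult_left_mono) auto
      finally show ?thesis .
    next
      case False
      show ?thesis unfolding zero[OF False] using \<Phi>[of x] \<open>\<epsilon> > 0\<close> by simp
    qed
    have "(\<Sum>i<n. b i / c) = 0" using R(3) \<kappa>(2) by (simp add: sum_divide_distrib[symmetric])
    then show "\<exists>\<psi> (n::nat) b y. \<psi> \<in> Cc \<and> (\<forall>x. 0 \<le> \<psi> x) \<and> (\<Sum>i<n. b i) = 0 \<and>
       (\<forall>x. \<bar>\<kappa> x - (\<Sum>i<n. b i * \<psi> (- y i + x))\<bar> \<le> \<epsilon> * (C * (\<Sum>l<m. \<phi> (- z l + x))))"
      using \<psi>(1,2) main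
      by (intro exI[of _ \<psi>] exI[of _ n] exI[of _ "\<lambda>i. b i / c"] exI[of _ y]) auto
  qed
qed

text \<open>Left and right translations commute, so left invariance shows that a combination of left
  translates of \<open>\<psi>\<close> with coefficient sum zero keeps integral zero after a right
  translation. The general case follows by approximation, and no double integral is needed.\<close>

lemma integral_right_translation_zero:
  assumes \<kappa>: "\<kappa> \<in> Cc" "integral\<^sup>L M \<kappa> = 0"
  shows "integral\<^sup>L M (\<lambda>x. \<kappa> (x + g)) = 0"
proof -
  obtain \<phi> :: "'a \<Rightarrow> real" where \<phi>: "\<phi> \<in> Cc" "\<And>x. 0 \<le> \<phi> x" "\<phi> 0 = 1"
    by (rule bump_UNIV) (rule that)
  then have \<phi>0: "\<phi> 0 > 0" by simp
  obtain C :: real and m :: nat and z where C: "C > 0" and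
    ap: "\<And>\<epsilon>. \<epsilon> > 0 \<Longrightarrow> \<exists>\<psi> (n::nat) b y. \<psi> \<in> Cc \<and> (\<forall>x. 0 \<le> \<psi> x) \<and> (\<Sum>i<n. b i) = 0 \<and>
       (\<forall>x. \<bar>\<kappa> x - (\<Sum>i<n. b i * \<psi> (- y i + x))\<bar> \<le> \<epsilon> * (C * (\<Sum>l<m. \<phi> (- z l + x))))"
    by (rule approx_by_translates[OF \<kappa> \<phi>(1,2) \<phi>0]) (rule that)
  define \<Phi> where "\<Phi> x = C * (\<Sum>l<m. \<phi> (- z l + x))" for x
  have \<Phi>: "\<Phi> \<in> Cc" unfolding \<Phi>_def by (intro Cc_cmult Cc_sum Cc_left \<phi>(1))
  define A where "A = integral\<^sup>L M (\<lambda>x. \<Phi> (x + g))"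
  have *: "\<bar>integral\<^sup>L M (\<lambda>x. \<kappa> (x + g))\<bar> \<le> \<epsilon> * A" if e: "\<epsilon> > 0" for \<epsilon>
  proof -
    obtain \<psi> and n :: nat and b y where \<psi>: "\<psi> \<in> Cc" "(\<Sum>i<n. b i) = 0"
      "\<And>x. \<bar>\<kappa> x - (\<Sum>i<n. b i * \<psi> (- y i + x))\<bar> \<le> \<epsilon> * \<Phi> x"
      using ap[OF e] unfolding \<Phi>_def[symmetric] by blast
    have \<psi>g: "(\<lambda>x. \<psi> (- y i + (x + g))) \<in> Cc" for i
      using Cc_right[OF Cc_left[OF \<psi>(1)]] .
    have "integral\<^sup>L M (\<lambda>x. \<psi> (- y i + (x + g))) = integral\<^sup>L M (\<lambda>x. \<psi> (x + g))" for i
      using integral_left_translation[OF Cc_measurable[OF Cc_right[OF \<psi>(1), of g]], of "- y i"]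
      by (simp add: add.assoc)
    then have "integral\<^sup>L M (\<lambda>x. \<Sum>i<n. b i * \<psi> (- y i + (x + g))) = (\<Sum>i<n. b i) * integral\<^sup>L M (\<lambda>x. \<psi> (x + g))"
      by (subst Bochner_Integration.integral_sum) (use Cc_integrable[OF \<psi>g] in \<open>auto simp: sum_distrib_right\<close>)
    then have "integral\<^sup>L M (\<lambda>x. \<kappa> (x + g)) = integral\<^sup>L M (\<lambda>x. \<kappa> (x + g) - (\<Sum>i<n. b i * \<psi> (- y i + (x + g))))"
      using Cc_integrable[OF Cc_right[OF \<kappa>(1)], of g] Cc_integrable[OF \<psi>g] \<psi>(2) by simp
    also have "\<bar>\<dots>\<bar> \<le> integral\<^sup>L M (\<lambda>x. \<epsilon> * \<Phi> (x + g))"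
      using Cc_integrable[OF Cc_right[OF \<kappa>(1)], of g] Cc_integrable[OF \<psi>g] Cc_integrable[OF Cc_right[OF \<Phi>], of g] \<psi>(3)
      by (intro abs_integral_bound) auto
    finally show ?thesis by (simp add: A_def)
  qed
  have "A \<ge> 0" unfolding A_def \<Phi>_def using C \<phi>(2) by (simp add: sum_nonneg)
  show ?thesis
  proof (rule ccontr)
    let ?I = "\<bar>integral\<^sup>L M (\<lambda>x. \<kappa> (x + g))\<bar>"
    assume "integral\<^sup>L M (\<lambda>x. \<kappa> (x + g)) \<noteq> 0"
    then have p: "?I > 0" by simp
    \<comment> \<open>This \<open>\<epsilon>\<close> makes the bound at most half of the quantity
      that it bounds.\<close>
    have "?I \<le> ?I / (2 * (A + 1)) * A" using p \<open>A \<ge> 0\<close> by (intro *) simp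
    also have "\<dots> = ?I * (A / (2 * (A + 1)))" by simp
    also have "\<dots> \<le> ?I * (1 / 2)" using \<open>A \<ge> 0\<close> by (intro mult_left_mono) (auto simp: field_simps)
    finally show False using p by simp
  qed
qed

text \<open>\<open>D g\<close> is the value of the modular function at \<open>- g\<close>.\<close>
lemma modular_function:
  obtains D where "\<And>u g. u \<in> Cc \<Longrightarrow> integral\<^sup>L M (\<lambda>x. u (x + g)) = D g * integral\<^sup>L M u"
proof -
  obtain \<phi> :: "'a \<Rightarrow> real" where \<phi>: "\<phi> \<in> Cc" "\<And>x. 0 \<le> \<phi> x" "\<phi> 0 = 1"
    by (rule bump_UNIV) (rule that)
  have J: "integral\<^sup>L M \<phi> > 0" by (rule integral_Cc_pos[OF \<phi>(1,2), of 0]) (simp add: \<phi>(3))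
  show ?thesis
  proof (rule that[of "\<lambda>g. integral\<^sup>L M (\<lambda>x. \<phi> (x + g)) / integral\<^sup>L M \<phi>"])
    fix u :: "'a \<Rightarrow> real" and g assume u: "u \<in> Cc"
    \<comment> \<open>With this factor \<open>u - s * \<phi>\<close> has integral zero, and right
      translates of such functions still do.\<close>
    define s where "s = integral\<^sup>L M u / integral\<^sup>L M \<phi>"
    have \<kappa>: "(\<lambda>x. u x - s * \<phi> x) \<in> Cc" by (intro Cc_diff Cc_cmult u \<phi>(1))
    have "integral\<^sup>L M (\<lambda>x. u x - s * \<phi> x) = 0"
      using Cc_integrable[OF u] Cc_integrable[OF \<phi>(1)] J by (simp add: s_def)
    from integral_right_translation_zero[OF \<kappa> this, of g]
    have "integral\<^sup>L M (\<lambda>x. u (x + g)) = s * integral\<^sup>L M (\<lambda>x. \<phi> (x + g))"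
      using Cc_integrable[OF Cc_right[OF u]] Cc_integrable[OF Cc_right[OF \<phi>(1)]] by simp
    then show "integral\<^sup>L M (\<lambda>x. u (x + g)) = integral\<^sup>L M (\<lambda>x. \<phi> (x + g)) / integral\<^sup>L M \<phi> * integral\<^sup>L M u"
      by (simp add: s_def)
  qed
qed

end

section \<open>Left convolution\<close>

context haar_group
begin

definition conv :: "('a \<Rightarrow> real) \<Rightarrow> ('a \<Rightarrow> real) \<Rightarrow> 'a \<Rightarrow> real" where
  "conv \<psi> f x = integral\<^sup>L M (\<lambda>h. \<psi> h * f (- h + x))"

lemma conv_integrand_Cc:
  fixes \<psi> f :: "'a \<Rightarrow> real"
  assumes "\<psi> \<in> Cc" "f \<in> bcontfun"
  shows "(\<lambda>h. \<psi> h * f (- h + x)) \<in> Cc"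
proof (rule Cc_mult_continuous[OF assms(1)])
  have f: "continuous_on UNIV f" using assms(2) by (simp add: bcontfun_def)
  show "continuous_on UNIV (\<lambda>h. f (- h + x))"
    by (rule continuous_on_compose2[OF f]) (intro continuous_intros, simp)
qed

lemma conv_integrable:
  "\<psi> \<in> Cc \<Longrightarrow> f \<in> bcontfun \<Longrightarrow> integrable M (\<lambda>h. \<psi> h * f (- h + x))"
  by (rule Cc_integrable[OF conv_integrand_Cc])

lemma conv_add:
  "\<psi>1 \<in> Cc \<Longrightarrow> \<psi>2 \<in> Cc \<Longrightarrow> f \<in> bcontfun \<Longrightarrow> conv (\<lambda>h. \<psi>1 h + \<psi>2 h) f x = conv \<psi>1 f x + conv \<psi>2 f x"
  unfolding conv_def by (simp add: distrib_right conv_integrable)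

lemma conv_diff:
  "\<psi>1 \<in> Cc \<Longrightarrow> \<psi>2 \<in> Cc \<Longrightarrow> f \<in> bcontfun \<Longrightarrow> conv (\<lambda>h. \<psi>1 h - \<psi>2 h) f x = conv \<psi>1 f x - conv \<psi>2 f x"
  unfolding conv_def by (simp add: left_diff_distrib conv_integrable)

lemma conv_cmult: "conv (\<lambda>h. c * \<psi> h) f x = c * conv \<psi> f x"
  unfolding conv_def by (simp add: mult.assoc)

lemma conv_sum:
  assumes "\<And>i. i \<in> I \<Longrightarrow> \<psi> i \<in> Cc" "f \<in> bcontfun"
  shows "conv (\<lambda>h. \<Sum>i\<in>I. \<psi> i h) f x = (\<Sum>i\<in>I. conv (\<psi> i) f x)"
  unfolding conv_def sum_distrib_right
  by (rule Bochner_Integration.integral_sum) (use assms conv_integrable in auto)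

lemma conv_mono:
  assumes "\<psi>1 \<in> Cc" "\<psi>2 \<in> Cc" "f \<in> bcontfun" "\<And>x. 0 \<le> f x" "\<And>x. \<psi>1 x \<le> \<psi>2 x"
  shows "conv \<psi>1 f x \<le> conv \<psi>2 f x"
  unfolding conv_def
  by (rule Bochner_Integration.integral_mono)
    (use assms conv_integrable in \<open>auto intro!: mult_right_mono\<close>)

lemma conv_left_translation:
  assumes "\<psi> \<in> Cc" "f \<in> bcontfun"
  shows "conv (\<lambda>h. \<psi> (a + h)) f x = conv \<psi> f (a + x)"
proof -
  have "(\<lambda>h. \<psi> h * f (- h + (a + x))) \<in> borel_measurable borel"
    by (rule Cc_measurable[OF conv_integrand_Cc[OF assms]])
  from integral_left_translation[OF this, of a] show ?thesis
    unfolding conv_def left_quotient_translate .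
qed

lemma conv_translates:
  assumes "\<psi> \<in> Cc" "f \<in> bcontfun"
  shows "conv (\<lambda>h. \<Sum>i\<in>I. b i * \<psi> (- y i + h)) f x = (\<Sum>i\<in>I. b i * conv \<psi> f (- y i + x))"
  using assms
  by (subst conv_sum) (auto intro!: Cc_cmult Cc_left simp: conv_cmult conv_left_translation)

lemma conv_bound:
  assumes "\<psi> \<in> Cc" "f \<in> bcontfun" "\<And>x. \<bar>f x\<bar> \<le> B"
  shows "\<bar>conv \<psi> f x\<bar> \<le> B * integral\<^sup>L M (\<lambda>h. \<bar>\<psi> h\<bar>)"
proof -
  have "\<bar>conv \<psi> f x\<bar> \<le> integral\<^sup>L M (\<lambda>h. B * \<bar>\<psi> h\<bar>)"
    unfolding conv_def
  proof (rule abs_integral_bound[OF conv_integrable[OF assms(1,2)]])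
    show "integrable M (\<lambda>h. B * \<bar>\<psi> h\<bar>)"
      by (rule Cc_integrable[OF Cc_cmult[OF Cc_abs[OF assms(1)]]])
    show "\<bar>\<psi> h * f (- h + x)\<bar> \<le> B * \<bar>\<psi> h\<bar>" for h
      unfolding abs_mult mult.commute[of B] by (intro mult_left_mono assms(3)) simp
  qed
  then show ?thesis by simp
qed

lemma conv_nonneg:
  assumes "\<And>x. 0 \<le> \<psi> x" "\<And>x. 0 \<le> f x"
  shows "0 \<le> conv \<psi> f x"
  unfolding conv_def using assms by simp

lemma conv_right_diff:
  assumes "\<psi> \<in> Cc" "f \<in> bcontfun"
  shows "conv \<psi> f (x + v) - conv \<psi> f x = conv \<psi> (\<lambda>y. f (y + v) - f y) x"
  unfolding conv_def add.assoc[symmetric]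
  using conv_integrable[OF assms, of "x + v"] conv_integrable[OF assms, of x]
  by (simp add: right_diff_distrib add.assoc)

text \<open>A left translation of \<open>conv \<psi> f\<close> acts on \<open>\<psi>\<close> alone,
  so a domination of the increments of \<open>\<psi>\<close> survives integration against
  \<open>f \<ge> 0\<close>. The result is a relative modulus of continuity, meaningful also where
  \<open>conv \<phi> f\<close> is small.\<close>

lemma conv_uniform_dominated:
  assumes \<phi>: "\<phi> \<in> Cc" "\<And>x. 0 \<le> \<phi> x" "\<phi> 0 > 0" and \<psi>: "\<psi> \<in> Cc"
    and f: "f \<in> bcontfun" "\<And>x. 0 \<le> f x"
  obtains C :: real and m :: nat and z where "C > 0"
    "\<And>d. d > 0 \<Longrightarrow> \<exists>U. open U \<and> 0 \<in> U \<and>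
       (\<forall>v\<in>U. \<forall>x. \<bar>conv \<psi> f (v + x) - conv \<psi> f x\<bar> \<le> d * (C * (\<Sum>l<m. conv \<phi> f (- z l + x))))"
proof -
  obtain C :: real and m :: nat and z where C: "C > 0"
    "\<And>d. d > 0 \<Longrightarrow> \<exists>U. open U \<and> 0 \<in> U \<and>
       (\<forall>v\<in>U. \<forall>x. \<bar>\<psi> (v + x) - \<psi> x\<bar> \<le> d * (C * (\<Sum>l<m. \<phi> (- z l + x))))"
    by (rule Cc_uniform_dominated_left[OF lc \<phi> \<psi>]) (rule that)
  define \<Phi> where "\<Phi> x = C * (\<Sum>l<m. \<phi> (- z l + x))" for x
  have \<Phi>: "\<Phi> \<in> Cc" unfolding \<Phi>_def by (intro Cc_cmult Cc_sum Cc_left \<phi>(1))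
  have conv_\<Phi>: "conv \<Phi> f x = C * (\<Sum>l<m. conv \<phi> f (- z l + x))" for x
    using conv_translates[OF \<phi>(1) f(1), where I = "{..<m}" and b = "\<lambda>_. 1" and y = z]
    unfolding \<Phi>_def by (simp add: conv_cmult)
  show ?thesis
  proof (rule that[OF C(1)])
    fix d :: real assume d: "d > 0"
    obtain U where U: "open U" "0 \<in> U" "\<And>v x. v \<in> U \<Longrightarrow> \<bar>\<psi> (v + x) - \<psi> x\<bar> \<le> d * \<Phi> x"
      using C(2)[OF d] unfolding \<Phi>_def by blast
    have "\<bar>conv \<psi> f (v + x) - conv \<psi> f x\<bar> \<le> d * (C * (\<Sum>l<m. conv \<phi> f (- z l + x)))"
      if v: "v \<in> U" for v x
    proof -
      have \<psi>v: "(\<lambda>h. \<psi> (v + h)) \<in> Cc" by (rule Cc_left[OF \<psi>])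
      have "conv (\<lambda>h. \<psi> (v + h) - \<psi> h) f x \<le> conv (\<lambda>h. d * \<Phi> h) f x"
        using U(3)[OF v] by (intro conv_mono f Cc_diff Cc_cmult \<psi>v \<psi> \<Phi>) (simp add: abs_le_iff)
      moreover have "conv (\<lambda>h. \<psi> h - \<psi> (v + h)) f x \<le> conv (\<lambda>h. d * \<Phi> h) f x"
        using U(3)[OF v] by (intro conv_mono f Cc_diff Cc_cmult \<psi>v \<psi> \<Phi>) (simp add: abs_le_iff)
      ultimately show ?thesis
        unfolding conv_diff[OF \<psi>v \<psi> f(1)] conv_diff[OF \<psi> \<psi>v f(1)] conv_cmult conv_\<Phi>
          conv_left_translation[OF \<psi> f(1)] by (simp add: abs_le_iff)
    qed
    then show "\<exists>U. open U \<and> 0 \<in> U \<and>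
       (\<forall>v\<in>U. \<forall>x. \<bar>conv \<psi> f (v + x) - conv \<psi> f x\<bar> \<le> d * (C * (\<Sum>l<m. conv \<phi> f (- z l + x))))"
      using U(1,2) by blast
  qed
qed

text \<open>Uniform continuity under small left factors comes from \<open>\<psi>\<close>, under
  small right factors from \<open>f\<close>.\<close>

lemma conv_Cb_u:
  assumes \<psi>: "\<psi> \<in> Cc" and f: "f \<in> Cb_lu" "\<And>x. 0 \<le> f x"
  shows "conv \<psi> f \<in> Cb_u"
proof -
  have fC: "f \<in> Cb" using f(1) by (simp add: Cb_lu_def)
  obtain B where B: "B > 0" "\<And>x. \<bar>f x\<bar> \<le> B" by (rule bcontfun_bound[OF fC]) (rule that)
  obtain \<phi> :: "'a \<Rightarrow> real" where \<phi>: "\<phi> \<in> Cc" "\<And>x. 0 \<le> \<phi> x" "\<phi> 0 = 1"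
    by (rule bump_UNIV) (rule that)
  then have \<phi>0: "\<phi> 0 > 0" by simp
  obtain C :: real and m :: nat and z where C: "C > 0"
    "\<And>d. d > 0 \<Longrightarrow> \<exists>U. open U \<and> 0 \<in> U \<and>
       (\<forall>v\<in>U. \<forall>x. \<bar>conv \<psi> f (v + x) - conv \<psi> f x\<bar> \<le> d * (C * (\<Sum>l<m. conv \<phi> f (- z l + x))))"
    by (rule conv_uniform_dominated[OF \<phi>(1,2) \<phi>0 \<psi> fC f(2)]) (rule that)
  define A where "A = C * (real m * (B * integral\<^sup>L M (\<lambda>h. \<bar>\<phi> h\<bar>)))"
  have A: "A \<ge> 0" unfolding A_def using C(1) B(1) by simp
  have le_A: "C * (\<Sum>l<m. conv \<phi> f (- z l + x)) \<le> A" for x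
  proof -
    have "(\<Sum>l<m. conv \<phi> f (- z l + x)) \<le> (\<Sum>l<m. B * integral\<^sup>L M (\<lambda>h. \<bar>\<phi> h\<bar>))"
      using conv_bound[OF \<phi>(1) fC B(2)] by (intro sum_mono) (simp add: abs_le_iff)
    then show ?thesis unfolding A_def using C(1) by (intro mult_left_mono) auto
  qed
  have left: "\<exists>U. open U \<and> 0 \<in> U \<and> (\<forall>v\<in>U. \<forall>x. \<bar>conv \<psi> f (v + x) - conv \<psi> f x\<bar> \<le> e)"
    if e: "e > 0" for e
  proof -
    have d: "e / (A + 1) > 0" using e A by simp
    have "e / (A + 1) * (C * (\<Sum>l<m. conv \<phi> f (- z l + x))) \<le> e" for x
    proof -
      have "e / (A + 1) * (C * (\<Sum>l<m. conv \<phi> f (- z l + x))) \<le> e / (A + 1) * (A + 1)"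
        using le_A[of x] d by (intro mult_left_mono) auto
      then show ?thesis using A by simp
    qed
    then show ?thesis using C(2)[OF d] by (meson order_trans)
  qed
  have right: "\<exists>U. open U \<and> 0 \<in> U \<and> (\<forall>v\<in>U. \<forall>x. \<bar>conv \<psi> f (x + v) - conv \<psi> f x\<bar> \<le> e)"
    if e: "e > 0" for e
  proof -
    define J where "J = integral\<^sup>L M (\<lambda>h. \<bar>\<psi> h\<bar>)"
    have J: "J \<ge> 0" unfolding J_def by simp
    have d: "e / (J + 1) > 0" using e J by simp
    obtain U where U: "open U" "0 \<in> U" "\<And>v x. v \<in> U \<Longrightarrow> \<bar>f (x + v) - f x\<bar> < e / (J + 1)"
      by (rule Cb_luD[OF f(1) d]) (rule that)
    have "\<bar>conv \<psi> f (x + v) - conv \<psi> f x\<bar> \<le> e" if v: "v \<in> U" for v x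
    proof -
      have bd: "\<bar>f (y + v) - f y\<bar> \<le> e / (J + 1)" for y using U(3)[OF v] by (simp add: less_imp_le)
      have fc: "continuous_on UNIV f" using fC by (simp add: bcontfun_def)
      have "continuous_on UNIV (\<lambda>y. f (y + v) - f y)"
        by (intro continuous_on_diff fc continuous_on_compose2[OF fc]) (auto intro!: continuous_intros)
      then have "(\<lambda>y. f (y + v) - f y) \<in> bcontfun" by (rule bcontfunI_bound[OF _ bd])
      from conv_bound[OF \<psi> this bd] have "\<bar>conv \<psi> f (x + v) - conv \<psi> f x\<bar> \<le> e / (J + 1) * J"
        unfolding conv_right_diff[OF \<psi> fC] J_def .
      also have "\<dots> \<le> e / (J + 1) * (J + 1)" using d by (intro mult_left_mono) auto
      also have "\<dots> = e" using J by simp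
      finally show ?thesis .
    qed
    then show ?thesis using U(1,2) by blast
  qed
  have "conv \<psi> f \<in> Cb"
    by (rule bcontfunI_bound[OF continuous_on_uniform_left[OF left] conv_bound[OF \<psi> fC B(2)]])
  then show ?thesis unfolding Cb_u_def using Cb_ruI[OF _ left] Cb_luI[OF _ right] by blast
qed

text \<open>Extends the translate property from finite combinations to averages with a signed weight
  \<open>w\<close>. The Riemann sum error is bounded by translates of \<open>conv \<phi> f\<close>
  itself; adding this bound restores nonnegativity and raises the total coefficient by a multiple of
  \<open>d\<close>, which is arbitrary.\<close>

lemma translate_property_integral:
  assumes tp: "translate_property (Cb_u :: ('a \<Rightarrow> real) set) top"
    and \<phi>: "\<phi> \<in> Cc" "\<And>x. 0 \<le> \<phi> x" "\<phi> 0 > 0"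
    and f: "f \<in> Cb_lu" "\<And>x. 0 \<le> f x" and nz: "conv \<phi> f a \<noteq> 0"
    and w: "w \<in> Cc" "\<And>x. 0 \<le> integral\<^sup>L M (\<lambda>k. w k * conv \<phi> f (k + x))"
  shows "0 \<le> integral\<^sup>L M w"
proof -
  define F where "F = conv \<phi> f"
  have fC: "f \<in> Cb" using f(1) by (simp add: Cb_lu_def)
  have F: "F \<in> Cb_u" "\<And>x. 0 \<le> F x" "F a \<noteq> 0"
    unfolding F_def using conv_Cb_u[OF \<phi>(1) f] conv_nonneg[OF \<phi>(2) f(2)] nz by auto
  have FC: "F \<in> Cb" using F(1) by (simp add: Cb_u_def Cb_ru_def)
  then have Fc: "continuous_on UNIV F" by (simp add: bcontfun_def)
  obtain B where B: "B > 0" "\<And>x. \<bar>F x\<bar> \<le> B" by (rule bcontfun_bound[OF FC]) (rule that)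
  obtain C :: real and m :: nat and z where C: "C > 0"
    "\<And>d. d > 0 \<Longrightarrow> \<exists>U. open U \<and> 0 \<in> U \<and>
       (\<forall>v\<in>U. \<forall>x. \<bar>conv \<phi> f (v + x) - conv \<phi> f x\<bar> \<le> d * (C * (\<Sum>l<m. conv \<phi> f (- z l + x))))"
    by (rule conv_uniform_dominated[OF \<phi> \<phi>(1) fC f(2)]) (rule that)
  define F' where "F' x = C * (\<Sum>l<m. F (- z l + x))" for x
  have F': "translate_combination F F' (C * (\<Sum>l<m. 1))"
    unfolding F'_def by (intro translate_combination_cmult translate_combination_sum
        translate_combination_translate finite_lessThan)
  define A where "A = integral\<^sup>L M (\<lambda>k. \<bar>w k\<bar>) * (C * (\<Sum>l<m. 1))"
  have A: "A \<ge> 0" unfolding A_def using C(1) by simp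
  obtain K where K: "compact K" "\<And>x. x \<notin> K \<Longrightarrow> w x = 0" by (rule CcE[OF w(1)]) (rule that)
  have *: "0 \<le> integral\<^sup>L M w + d * A" if d: "d > 0" for d
  proof -
    obtain U where U: "open U" "0 \<in> U" "\<And>v x. v \<in> U \<Longrightarrow> \<bar>F (v + x) - F x\<bar> \<le> d * F' x"
      using C(2)[OF d] unfolding F'_def F_def by blast
    have fam: "open {k. k + - b \<in> U}" "b \<in> {k. k + - b \<in> U}" for b
      using open_right_translate[OF U(1), of "- b"] U(2) by auto
    obtain n :: nat and y b c where R: "\<And>i. i < n \<Longrightarrow> y i \<in> K" "\<And>i. 0 \<le> c i"
      "(\<Sum>i<n. b i) = integral\<^sup>L M w" "(\<Sum>i<n. c i) = integral\<^sup>L M (\<lambda>x. \<bar>w x\<bar>)"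
      "\<forall>h e B. h \<in> borel_measurable borel \<longrightarrow> (\<forall>x. \<bar>h x\<bar> \<le> B) \<longrightarrow>
       (\<forall>i<n. \<forall>k\<in>{k. k + - y i \<in> U}. \<bar>h k - h (y i)\<bar> \<le> e i) \<longrightarrow>
       \<bar>integral\<^sup>L M (\<lambda>x. w x * h x) - (\<Sum>i<n. b i * h (y i))\<bar> \<le> (\<Sum>i<n. c i * e i)"
      by (rule Riemann_sum[where U = "\<lambda>a. {k. k + - a \<in> U}", OF w(1) K(1) _ fam])
        (rule K(2), assumption, rule that)
    \<comment> \<open>The second sum is the error bound. It makes \<open>u\<close> nonnegative and
      contributes \<open>d * A\<close> to the total coefficient.\<close>
    define u where "u x = (\<Sum>i<n. b i * F (y i + x)) + (\<Sum>i<n. d * c i * F' (y i + x))" for x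
    have "translate_combination F u ((\<Sum>i<n. b i * 1) + (\<Sum>i<n. d * c i * (C * (\<Sum>l<m. 1))))"
      unfolding u_def
      by (intro translate_combination_add translate_combination_sum translate_combination_cmult
          translate_combination_translate translate_combination_left[OF F'] finite_lessThan)
    moreover have "0 \<le> u x" for x
    proof -
      have "\<bar>integral\<^sup>L M (\<lambda>k. w k * F (k + x)) - (\<Sum>i<n. b i * F (y i + x))\<bar>
          \<le> (\<Sum>i<n. c i * (d * F' (y i + x)))"
      proof (rule R(5)[rule_format, where B = B])
        show "(\<lambda>k. F (k + x)) \<in> borel_measurable borel"
          by (intro borel_measurable_continuous_onI continuous_on_compose2[OF Fc])
            (auto intro!: continuous_intros)
        fix i k assume "k \<in> {k. k + - y i \<in> U}"
        then show "\<bar>F (k + x) - F (y i + x)\<bar> \<le> d * F' (y i + x)"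
          using U(3)[of "k + - y i" "y i + x"] by (simp only: add.assoc minus_add_cancel mem_Collect_eq)
      qed (rule B(2))
      then show ?thesis using w(2)[of x] unfolding u_def F_def[symmetric]
        by (simp add: abs_le_iff mult_ac)
    qed
    ultimately have "0 \<le> (\<Sum>i<n. b i * 1) + (\<Sum>i<n. d * c i * (C * (\<Sum>l<m. 1)))"
      by (rule translate_combination_nonneg[OF tp F])
    also have "\<dots> = integral\<^sup>L M w + d * A"
      by (simp add: R(3,4) A_def sum_distrib_left[symmetric] sum_distrib_right[symmetric])
    finally show ?thesis .
  qed
  show ?thesis
  proof (rule field_le_epsilon)
    fix e :: real assume e: "e > 0"
    have "e / (A + 1) * A \<le> e / (A + 1) * (A + 1)" using e A by (intro mult_left_mono) auto
    also have "\<dots> = e" using A by simp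
    finally show "0 \<le> integral\<^sup>L M w + e" using *[of "e / (A + 1)"] e A by simp
  qed
qed

end

section \<open>Almost invariant functions\<close>

text \<open>Meant for the Green function of the random walk, a uniform limit of compactly supported
  functions that need not have compact support.\<close>

lemma Cb_u_uniform_approx:
  fixes f :: "'a::topological_group_add \<Rightarrow> real"
  assumes ap: "\<And>e. e > 0 \<Longrightarrow> \<exists>h\<in>Cc. \<forall>x. \<bar>f x - h x\<bar> \<le> e"
  shows "f \<in> Cb_u"
proof -
  have left: "\<exists>U. open U \<and> 0 \<in> U \<and> (\<forall>v\<in>U. \<forall>x. \<bar>f (v + x) - f x\<bar> \<le> e)" if e: "e > 0" for e
  proof -
    have e3: "e / 3 > 0" using e by simp
    obtain h where h: "h \<in> Cc" "\<And>x. \<bar>f x - h x\<bar> \<le> e / 3" using ap[OF e3] by blast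
    obtain U where U: "open U" "0 \<in> U" "\<And>v x. v \<in> U \<Longrightarrow> \<bar>h (v + x) - h x\<bar> < e / 3"
      by (rule Cc_uniform_left[OF h(1) e3]) (rule that)
    have "\<bar>f (v + x) - f x\<bar> \<le> e" if "v \<in> U" for v x
      using U(3)[OF that, of x] h(2)[of x] h(2)[of "v + x"] by linarith
    then show ?thesis using U(1,2) by blast
  qed
  have right: "\<exists>U. open U \<and> 0 \<in> U \<and> (\<forall>v\<in>U. \<forall>x. \<bar>f (x + v) - f x\<bar> \<le> e)" if e: "e > 0" for e
  proof -
    have e3: "e / 3 > 0" using e by simp
    obtain h where h: "h \<in> Cc" "\<And>x. \<bar>f x - h x\<bar> \<le> e / 3" using ap[OF e3] by blast
    obtain U where U: "open U" "0 \<in> U" "\<And>v x. v \<in> U \<Longrightarrow> \<bar>h (x + v) - h x\<bar> < e / 3"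
      by (rule Cc_uniform_right[OF h(1) e3]) (rule that)
    have "\<bar>f (x + v) - f x\<bar> \<le> e" if "v \<in> U" for v x
      using U(3)[OF that, of x] h(2)[of x] h(2)[of "x + v"] by linarith
    then show ?thesis using U(1,2) by blast
  qed
  obtain h where h: "h \<in> Cc" "\<And>x. \<bar>f x - h x\<bar> \<le> 1" using ap[of 1] by auto
  obtain B where B: "B > 0" "\<And>x. \<bar>h x\<bar> \<le> B" by (rule Cc_bounded[OF h(1)]) (rule that)
  have fB: "\<bar>f x\<bar> \<le> B + 1" for x using h(2)[of x] B(2)[of x] by linarith
  have "f \<in> Cb" by (rule bcontfunI_bound[OF continuous_on_uniform_left[OF left] fB])
  then show ?thesis unfolding Cb_u_def using Cb_ruI[OF _ left] Cb_luI[OF _ right] by blast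
qed

text \<open>The mean of the squares exceeds the square of the mean \<open>m\<close> by
  \<open>V / N\<close>, where \<open>V\<close> is the sum of squared deviations from
  \<open>m\<close>. Each \<open>b i - a\<close> splits at \<open>m\<close>, and summing the squares
  gives at most \<open>2 * N * V\<close>.\<close>

lemma mean_square_le:
  fixes a :: real and b :: "nat \<Rightarrow> real" and n :: nat
  defines "N \<equiv> real n + 1"
  shows "((a + (\<Sum>i<n. b i)) / N)\<^sup>2
    \<le> (a\<^sup>2 + (\<Sum>i<n. (b i)\<^sup>2)) / N - (\<Sum>i<n. (b i - a)\<^sup>2) / (2 * N\<^sup>2)"
proof -
  have N: "N > 0" by (simp add: N_def)
  define m where "m = (a + (\<Sum>i<n. b i)) / N"
  have Nm: "a + (\<Sum>i<n. b i) = N * m" using N by (simp add: m_def)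
  define V where "V = (a - m)\<^sup>2 + (\<Sum>i<n. (b i - m)\<^sup>2)"
  have "V = a\<^sup>2 + (\<Sum>i<n. (b i)\<^sup>2) - 2 * m * (a + (\<Sum>i<n. b i)) + N * m\<^sup>2"
    by (simp add: V_def N_def power2_diff sum.distrib sum_subtractf sum_distrib_left algebra_simps)
  then have V: "V = a\<^sup>2 + (\<Sum>i<n. (b i)\<^sup>2) - N * m\<^sup>2"
    unfolding Nm by (simp add: power2_eq_square)
  have "(\<Sum>i<n. (b i - a)\<^sup>2) \<le> (\<Sum>i<n. 2 * (b i - m)\<^sup>2 + 2 * (a - m)\<^sup>2)"
  proof (rule sum_mono)
    fix i
    have "2 * (b i - m)\<^sup>2 + 2 * (a - m)\<^sup>2 - (b i - a)\<^sup>2 = (b i + a - 2 * m)\<^sup>2"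
      by (simp add: power2_eq_square algebra_simps)
    then show "(b i - a)\<^sup>2 \<le> 2 * (b i - m)\<^sup>2 + 2 * (a - m)\<^sup>2"
      by (metis diff_ge_0_iff_ge zero_le_power2)
  qed
  also have "\<dots> = 2 * (\<Sum>i<n. (b i - m)\<^sup>2) + 2 * real n * (a - m)\<^sup>2"
    by (simp add: sum.distrib sum_distrib_left)
  also have "\<dots> \<le> 2 * N * V"
  proof -
    have "2 * N * V - (2 * (\<Sum>i<n. (b i - m)\<^sup>2) + 2 * real n * (a - m)\<^sup>2)
      = 2 * (a - m)\<^sup>2 + 2 * (real n * (\<Sum>i<n. (b i - m)\<^sup>2))"
      by (simp add: V_def N_def algebra_simps)
    also have "\<dots> \<ge> 0" by (simp add: sum_nonneg)
    finally show ?thesis by simp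
  qed
  finally have "(\<Sum>i<n. (b i - a)\<^sup>2) / (2 * N\<^sup>2) \<le> (2 * N * V) / (2 * N\<^sup>2)"
    by (rule divide_right_mono) simp
  also have "\<dots> = (a\<^sup>2 + (\<Sum>i<n. (b i)\<^sup>2)) / N - m\<^sup>2"
    using N unfolding V by (simp add: field_simps power2_eq_square)
  finally show ?thesis by (simp add: m_def)
qed

section \<open>Averaging operators and the spectral gap\<close>

context haar_group
begin

text \<open>A lazy step of the walk: because \<open>u\<close> itself is one of the averaged
  functions, the loss of square norm is bounded below by the differences between \<open>u\<close>
  and its translates.\<close>

definition avg :: "nat \<Rightarrow> (nat \<Rightarrow> 'a) \<Rightarrow> ('a \<Rightarrow> real) \<Rightarrow> 'a \<Rightarrow> real" where
  "avg n g u x = (u x + (\<Sum>i<n. u (g i + x))) / (real n + 1)"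

lemma avg_Cc: "u \<in> Cc \<Longrightarrow> avg n g u \<in> Cc"
proof -
  assume u: "u \<in> Cc"
  have "(\<lambda>x. (1 / (real n + 1)) * (u x + (\<Sum>i<n. u (g i + x)))) \<in> Cc"
    by (intro Cc_cmult Cc_add Cc_sum Cc_left u)
  then show ?thesis by (simp add: avg_def[abs_def])
qed

text \<open>Only left translations are averaged, so \<open>avg\<close> commutes with the right
  translation by \<open>v\<close>. This carries a comparison of \<open>\<phi>\<close> with right
  translates through all powers of the operator.\<close>

lemma avg_mono_right:
  "(\<And>x. u x \<le> u' (x + v)) \<Longrightarrow> avg n g u x \<le> avg n g u' (x + v)"
  unfolding avg_def
  by (intro divide_right_mono add_mono sum_mono) (simp_all add: add.assoc[symmetric])

lemma avg_nonneg: "(\<And>x. 0 \<le> u x) \<Longrightarrow> 0 \<le> avg n g u x"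
  unfolding avg_def by (simp add: sum_nonneg)

lemma avg_pow_Cc: "u \<in> Cc \<Longrightarrow> (avg n g ^^ m) u \<in> Cc"
  by (induction m) (auto intro: avg_Cc)

lemma avg_pow_nonneg: "(\<And>x. 0 \<le> u x) \<Longrightarrow> 0 \<le> (avg n g ^^ m) u x"
  by (induction m arbitrary: x) (auto intro: avg_nonneg)

lemma avg_pow_mono_right:
  "(\<And>x. u x \<le> u' (x + v)) \<Longrightarrow> (avg n g ^^ m) u x \<le> (avg n g ^^ m) u' (x + v)"
  by (induction m arbitrary: x) (auto intro: avg_mono_right)

text \<open>The pointwise inequality \<open>mean_square_le\<close> is integrated; left invariance
  makes all the square terms equal.\<close>

lemma integral_avg_square_le:
  assumes u: "u \<in> Cc"
  shows "integral\<^sup>L M (\<lambda>x. (avg n g u x)\<^sup>2) \<le> integral\<^sup>L M (\<lambda>x. (u x)\<^sup>2)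
    - (\<Sum>i<n. integral\<^sup>L M (\<lambda>x. (u (g i + x) - u x)\<^sup>2)) / (2 * (real n + 1)\<^sup>2)"
proof -
  have u2: "integrable M (\<lambda>x. (u x)\<^sup>2)" by (rule Cc_integrable[OF Cc_power2[OF u]])
  have ug2: "integrable M (\<lambda>x. (u (g i + x))\<^sup>2)" for i
    by (rule Cc_integrable[OF Cc_power2[OF Cc_left[OF u]]])
  have ud2: "integrable M (\<lambda>x. (u (g i + x) - u x)\<^sup>2)" for i
    by (rule Cc_integrable[OF Cc_power2[OF Cc_diff[OF Cc_left[OF u] u]]])
  have inv: "integral\<^sup>L M (\<lambda>x. (u (g i + x))\<^sup>2) = integral\<^sup>L M (\<lambda>x. (u x)\<^sup>2)" for i
    by (rule integral_left_translation[OF Cc_measurable[OF Cc_power2[OF u]]])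
  have "integral\<^sup>L M (\<lambda>x. (avg n g u x)\<^sup>2) \<le> integral\<^sup>L M (\<lambda>x. ((u x)\<^sup>2 + (\<Sum>i<n. (u (g i + x))\<^sup>2)) / (real n + 1)
      - (\<Sum>i<n. (u (g i + x) - u x)\<^sup>2) / (2 * (real n + 1)\<^sup>2))"
    by (rule Bochner_Integration.integral_mono)
      (use u2 ug2 ud2 mean_square_le Cc_integrable[OF Cc_power2[OF avg_Cc[OF u]]] in
        \<open>auto simp: avg_def\<close>)
  also have "\<dots> = (integral\<^sup>L M (\<lambda>x. (u x)\<^sup>2) + (\<Sum>i<n. integral\<^sup>L M (\<lambda>x. (u (g i + x))\<^sup>2))) / (real n + 1)
      - (\<Sum>i<n. integral\<^sup>L M (\<lambda>x. (u (g i + x) - u x)\<^sup>2)) / (2 * (real n + 1)\<^sup>2)"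
    using u2 ug2 ud2 by simp
  also have "(integral\<^sup>L M (\<lambda>x. (u x)\<^sup>2) + (\<Sum>i<n. integral\<^sup>L M (\<lambda>x. (u (g i + x))\<^sup>2))) / (real n + 1)
      = integral\<^sup>L M (\<lambda>x. (u x)\<^sup>2)"
    unfolding inv by (simp add: field_simps)
  finally show ?thesis .
qed

text \<open>If left translations had a spectral gap on \<open>L\<^sup>2\<close>, the averaging operator \<open>P\<close> would contract
  by some \<open>\<rho> < 1\<close>, and \<open>f = (\<Sum>m. r ^ m * P\<^sup>m \<phi>)\<close> with \<open>1 < r < 1 / \<rho>\<close> would satisfy
  \<open>f - r P f = \<phi> \<ge> 0\<close>, violating the translate property.\<close>
lemma no_spectral_gap:
  fixes n :: nat and g :: "nat \<Rightarrow> 'a"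
  assumes tp: "translate_property (Cb_u :: ('a \<Rightarrow> real) set) top" and \<kappa>: "0 < \<kappa>" "\<kappa> \<le> 1"
  shows "\<exists>u\<in>Cc. (\<Sum>i<n. integral\<^sup>L M (\<lambda>x. (u (g i + x) - u x)\<^sup>2)) < \<kappa> * integral\<^sup>L M (\<lambda>x. (u x)\<^sup>2)"
proof (rule ccontr)
  assume "\<not> ?thesis"
  then have gap: "\<kappa> * integral\<^sup>L M (\<lambda>x. (u x)\<^sup>2) \<le> (\<Sum>i<n. integral\<^sup>L M (\<lambda>x. (u (g i + x) - u x)\<^sup>2))"
    if "u \<in> Cc" for u using that by (meson not_less)
  define N where "N = real n + 1"
  have N: "N \<ge> 1" by (simp add: N_def)
  \<comment> \<open>The factor by which the assumed gap and \<open>integral_avg_square_le\<close>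
    shrink the square norm; \<open>\<kappa> \<le> 1\<close> keeps it positive.\<close>
  define q where "q = 1 - \<kappa> / (2 * N\<^sup>2)"
  have "N\<^sup>2 \<ge> 1" using N by simp
  then have "\<kappa> / (2 * N\<^sup>2) \<le> 1 / 2" using \<kappa> by (simp add: divide_le_eq)
  moreover have "\<kappa> / (2 * N\<^sup>2) > 0" using \<kappa> N by simp
  ultimately have q: "0 < q" "q < 1" by (auto simp: q_def)
  let ?P = "avg n g"
  have step: "integral\<^sup>L M (\<lambda>x. (?P u x)\<^sup>2) \<le> q * integral\<^sup>L M (\<lambda>x. (u x)\<^sup>2)" if u: "u \<in> Cc" for u
  proof -
    have "integral\<^sup>L M (\<lambda>x. (?P u x)\<^sup>2) \<le> integral\<^sup>L M (\<lambda>x. (u x)\<^sup>2)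
      - (\<Sum>i<n. integral\<^sup>L M (\<lambda>x. (u (g i + x) - u x)\<^sup>2)) / (2 * N\<^sup>2)"
      using integral_avg_square_le[OF u] by (simp add: N_def)
    also have "\<dots> \<le> integral\<^sup>L M (\<lambda>x. (u x)\<^sup>2) - \<kappa> * integral\<^sup>L M (\<lambda>x. (u x)\<^sup>2) / (2 * N\<^sup>2)"
      using gap[OF u] by (intro diff_left_mono divide_right_mono) auto
    also have "\<dots> = q * integral\<^sup>L M (\<lambda>x. (u x)\<^sup>2)" by (simp add: q_def left_diff_distrib)
    finally show ?thesis .
  qed
  have pow: "integral\<^sup>L M (\<lambda>x. ((?P ^^ m) u x)\<^sup>2) \<le> q ^ m * integral\<^sup>L M (\<lambda>x. (u x)\<^sup>2)" if u: "u \<in> Cc" for u m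
  proof (induction m)
    case (Suc m)
    have "integral\<^sup>L M (\<lambda>x. ((?P ^^ Suc m) u x)\<^sup>2) \<le> q * integral\<^sup>L M (\<lambda>x. ((?P ^^ m) u x)\<^sup>2)"
      using step[OF avg_pow_Cc[OF u]] by simp
    also have "\<dots> \<le> q * (q ^ m * integral\<^sup>L M (\<lambda>x. (u x)\<^sup>2))"
      using Suc q by (intro mult_left_mono) auto
    finally show ?case by simp
  qed simp
  obtain W L :: "'a set" where WL: "open W" "compact L" "0 \<in> W" "W \<subseteq> L"
    by (rule compact_nbhd[OF lc]) (rule that)
  obtain \<phi> :: "'a \<Rightarrow> real" where \<phi>: "\<phi> \<in> Cc" "\<And>x. 0 \<le> \<phi> x" "\<And>x. \<phi> x \<le> 1" "\<phi> 0 = 1"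
    "\<And>x. x \<notin> W \<Longrightarrow> \<phi> x = 0"
    by (rule bump_exists[OF lc WL(1,3)]) (rule that)
  have \<phi>0: "\<phi> 0 > 0" using \<phi>(4) by simp
  have LL: "compact ((\<lambda>(x, y). x + y) ` (L \<times> L))" by (intro compact_plus_set WL(2))
  obtain C :: real and k :: nat and z where
    C: "C > 0" "\<And>x. x \<in> (\<lambda>(x, y). x + y) ` (L \<times> L) \<Longrightarrow> 1 \<le> C * (\<Sum>l<k. \<phi> (- z l + x))"
    by (rule Cc_dominated_cover[OF \<phi>(1,2) \<phi>0 LL]) (rule that)
  \<comment> \<open>At least 1 on \<open>L + L\<close>, so that
    \<open>\<phi> x \<le> \<phi>1 (x + v)\<close> for every \<open>v \<in> W\<close>.\<close>
  define \<phi>1 where "\<phi>1 x = C * (\<Sum>l<k. \<phi> (- z l + x))" for x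
  have \<phi>1: "\<phi>1 \<in> Cc" unfolding \<phi>1_def by (intro Cc_cmult Cc_sum Cc_left \<phi>(1))
  have \<phi>1n: "0 \<le> \<phi>1 x" for x unfolding \<phi>1_def using C(1) \<phi>(2) by (simp add: sum_nonneg)
  have \<phi>_le: "\<phi> x \<le> \<phi>1 (x + v)" if v: "v \<in> W" for x v
  proof (cases "x \<in> W")
    case True
    then have "x + v \<in> (\<lambda>(x, y). x + y) ` (L \<times> L)" using v WL(4) by force
    from C(2)[OF this] show ?thesis using \<phi>(3)[of x] unfolding \<phi>1_def by linarith
  qed (use \<phi>(5) \<phi>1n in simp)
  define J where "J = integral\<^sup>L M \<phi>"
  have J: "J > 0" unfolding J_def by (rule integral_Cc_pos[OF \<phi>(1,2) \<phi>0])
  define A where "A = integral\<^sup>L M (\<lambda>x. (\<phi>1 x)\<^sup>2) / J"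
  have A: "A \<ge> 0" unfolding A_def using J by simp
  define U where "U m = (?P ^^ m) \<phi>" for m
  have U: "U m \<in> Cc" "0 \<le> U m x" for m x
    unfolding U_def using avg_pow_Cc[OF \<phi>(1)] avg_pow_nonneg[of \<phi>] \<phi>(2) by auto
  \<comment> \<open>The decay in square norm becomes pointwise: \<open>U m x\<close> is at most the
    iterate of \<open>\<phi>1\<close> at \<open>x + v\<close> for all \<open>v \<in> W\<close>, and
    averaging the squares over \<open>v\<close> with weight \<open>\<phi>\<close> compares it with a
    square integral.\<close>
  have U_sq: "(U m x)\<^sup>2 \<le> q ^ m * A" for m x
  proof -
    let ?u = "(?P ^^ m) \<phi>1"
    have u: "?u \<in> Cc" by (rule avg_pow_Cc[OF \<phi>1])
    have le: "\<phi> v * (U m x)\<^sup>2 \<le> (?u (x + v))\<^sup>2" for v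
    proof (cases "v \<in> W")
      case True
      have "U m x \<le> ?u (x + v)" unfolding U_def by (rule avg_pow_mono_right) (rule \<phi>_le[OF True])
      then have "(U m x)\<^sup>2 \<le> (?u (x + v))\<^sup>2" using U(2) by (intro power_mono) auto
      moreover have "\<phi> v * (U m x)\<^sup>2 \<le> 1 * (U m x)\<^sup>2" using \<phi>(3) by (intro mult_right_mono) auto
      ultimately show ?thesis by simp
    qed (simp add: \<phi>(5))
    have "J * (U m x)\<^sup>2 = integral\<^sup>L M (\<lambda>v. \<phi> v * (U m x)\<^sup>2)" by (simp add: J_def)
    also have "\<dots> \<le> integral\<^sup>L M (\<lambda>v. (?u (x + v))\<^sup>2)"
      by (rule Bochner_Integration.integral_mono)
        (use Cc_integrable[OF \<phi>(1)] Cc_integrable[OF Cc_power2[OF Cc_left[OF u]]] le in auto)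
    also have "\<dots> = integral\<^sup>L M (\<lambda>v. (?u v)\<^sup>2)"
      by (rule integral_left_translation[OF Cc_measurable[OF Cc_power2[OF u]]])
    also have "\<dots> \<le> q ^ m * integral\<^sup>L M (\<lambda>x. (\<phi>1 x)\<^sup>2)" by (rule pow[OF \<phi>1])
    also have "\<dots> = J * (q ^ m * A)" using J by (simp add: A_def)
    finally show ?thesis using J by simp
  qed
  define \<rho> where "\<rho> = sqrt q"
  have \<rho>: "0 < \<rho>" "\<rho> < 1" using q by (auto simp: \<rho>_def)
  define D where "D = sqrt A"
  have U_le: "U m x \<le> \<rho> ^ m * D" for m x
  proof -
    have "U m x = sqrt ((U m x)\<^sup>2)" using U(2) by simp
    also have "\<dots> \<le> sqrt (q ^ m * A)" using U_sq by (rule real_sqrt_le_mono)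
    also have "\<dots> = \<rho> ^ m * D" by (simp add: \<rho>_def D_def real_sqrt_mult real_sqrt_power)
    finally show ?thesis .
  qed
  \<comment> \<open>The midpoint of 1 and \<open>1 / \<rho>\<close>: large enough for a negative
    total coefficient \<open>1 - r\<close>, small enough for \<open>s = r * \<rho> < 1\<close>,
    which makes the series converge uniformly.\<close>
  define r where "r = (1 + 1 / \<rho>) / 2"
  have r: "r > 1" using \<rho> by (simp add: r_def field_simps)
  define s where "s = r * \<rho>"
  have "s = (\<rho> + 1) / 2" using \<rho> by (simp add: s_def r_def field_simps)
  then have s: "0 < s" "s < 1" using \<rho> by auto
  have bd: "norm (r ^ m * U m x) \<le> D * s ^ m" for m x
  proof -
    have "norm (r ^ m * U m x) = r ^ m * U m x" using U(2) r by simp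
    also have "\<dots> \<le> r ^ m * (\<rho> ^ m * D)" using U_le r by (intro mult_left_mono) auto
    finally show ?thesis by (simp add: s_def power_mult_distrib mult_ac)
  qed
  have sumD: "summable (\<lambda>m. D * s ^ m)" using s by (intro summable_mult summable_geometric) auto
  define f where "f x = (\<Sum>m. r ^ m * U m x)" for x
  have sums: "(\<lambda>m. r ^ m * U m x) sums f x" for x
    unfolding f_def by (rule summable_sums[OF summable_comparison_test'[OF sumD bd]])
  have lim: "uniform_limit UNIV (\<lambda>k x. \<Sum>m<k. r ^ m * U m x) f sequentially"
    unfolding f_def by (rule Weierstrass_m_test[OF bd sumD])
  have fU: "f \<in> Cb_u"
  proof (rule Cb_u_uniform_approx)
    fix e :: real assume "e > 0"
    from uniform_limitD[OF lim this] obtain k where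
      "\<forall>x. dist (\<Sum>m<k. r ^ m * U m x) (f x) < e"
      unfolding eventually_sequentially by auto
    then have "\<forall>x. \<bar>f x - (\<Sum>m<k. r ^ m * U m x)\<bar> \<le> e"
      by (auto simp: dist_real_def abs_minus_commute less_imp_le)
    moreover have "(\<lambda>x. \<Sum>m<k. r ^ m * U m x) \<in> Cc" by (intro Cc_sum Cc_cmult U(1))
    ultimately show "\<exists>h\<in>Cc. \<forall>x. \<bar>f x - h x\<bar> \<le> e" by (rule bexI)
  qed
  have f_nonneg: "0 \<le> f x" for x
    unfolding f_def by (rule suminf_nonneg[OF sums_summable[OF sums]]) (use U(2) r in simp)
  \<comment> \<open>Applying \<open>r\<close> times the averaging operator shifts the series by one
    index, so the difference is its term at index 0, which is \<open>\<phi>\<close>.\<close>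
  have eq: "f x + - (r / N) * (f x + (\<Sum>i<n. f (g i + x))) = \<phi> x" for x
  proof -
    have 1: "(\<lambda>m. (r / N) * (r ^ m * U m x + (\<Sum>i<n. r ^ m * U m (g i + x)))) sums
        ((r / N) * (f x + (\<Sum>i<n. f (g i + x))))"
      by (intro sums_mult sums_add sums_sum sums)
    have "(r / N) * (r ^ m * U m x + (\<Sum>i<n. r ^ m * U m (g i + x))) = r ^ Suc m * U (Suc m) x" for m
    proof -
      have "U (Suc m) x = (U m x + (\<Sum>i<n. U m (g i + x))) / N"
        by (simp add: U_def avg_def N_def)
      moreover have "(\<Sum>i<n. r ^ m * U m (g i + x)) = r ^ m * (\<Sum>i<n. U m (g i + x))"
        by (rule sum_distrib_left[symmetric])
      ultimately show ?thesis by (simp add: add_divide_distrib algebra_simps)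
    qed
    then have "(\<lambda>m. r ^ Suc m * U (Suc m) x) sums ((r / N) * (f x + (\<Sum>i<n. f (g i + x))))"
      using 1 by simp
    moreover have "(\<lambda>m. r ^ Suc m * U (Suc m) x) sums (f x - r ^ 0 * U 0 x)"
      using sums[of x] by (subst sums_Suc_iff) simp
    ultimately have "(r / N) * (f x + (\<Sum>i<n. f (g i + x))) = f x - U 0 x"
      using sums_unique2 by fastforce
    then show ?thesis by (simp add: U_def)
  qed
  have f0: "f 0 \<noteq> 0"
  proof -
    have "f 0 \<ge> \<phi> 0"
    proof -
      have "0 \<le> (r / N) * (f 0 + (\<Sum>i<n. f (g i + 0)))"
        using r N f_nonneg by (intro mult_nonneg_nonneg add_nonneg_nonneg sum_nonneg) auto
      then show ?thesis using eq[of 0] by simp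
    qed
    then show ?thesis using \<phi>0 by simp
  qed
  have comb: "translate_combination f (\<lambda>x. f x + - (r / N) * (f x + (\<Sum>i<n. f (g i + x))))
      (1 + - (r / N) * (1 + (\<Sum>i<n. 1)))"
    by (intro translate_combination_add translate_combination_sum translate_combination_cmult
        translate_combination_translate translate_combination_self finite_lessThan)
  have "0 \<le> 1 + - (r / N) * (1 + (\<Sum>i<n. 1))"
    by (rule translate_combination_nonneg[OF tp fU f_nonneg f0 comb]) (unfold eq, rule \<phi>(2))
  also have "\<dots> = 1 - r" using N by (simp add: N_def field_simps)
  finally show False using r by simp
qed

text \<open>Reiter's condition, with \<open>\<theta> = u\<^sup>2\<close> for an almost invariant \<open>u\<close> in \<open>L\<^sup>2\<close>.\<close>
lemma almost_invariant_function:
  fixes n :: nat and g :: "nat \<Rightarrow> 'a"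
  assumes tp: "translate_property (Cb_u :: ('a \<Rightarrow> real) set) top" and \<epsilon>: "0 < \<epsilon>" "\<epsilon> \<le> 1"
  obtains \<theta> where "\<theta> \<in> Cc" "\<And>x. 0 \<le> \<theta> x" "integral\<^sup>L M \<theta> > 0"
    "\<And>i. i < n \<Longrightarrow> integral\<^sup>L M (\<lambda>x. \<bar>\<theta> (g i + x) - \<theta> x\<bar>) \<le> \<epsilon> * integral\<^sup>L M \<theta>"
proof -
  \<comment> \<open>The inequality \<open>pw\<close> costs \<open>s * A\<close> for the squared
    difference, since that is at most \<open>2 * s\<^sup>2 * A\<close>, and \<open>2 * s * A\<close>
    for the sum of squares; together this is \<open>\<epsilon> * A\<close>.\<close>
  define s where "s = \<epsilon> / 3"
  have s: "s > 0" "s \<le> 1 / 3" using \<epsilon> by (auto simp: s_def)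
  have "s * s \<le> 1 / 3 * (1 / 3)" using s by (intro mult_mono) auto
  then have \<kappa>: "0 < 2 * s\<^sup>2" "2 * s\<^sup>2 \<le> 1" using s by (auto simp: power2_eq_square)
  obtain u where u: "u \<in> Cc"
    "(\<Sum>i<n. integral\<^sup>L M (\<lambda>x. (u (g i + x) - u x)\<^sup>2)) < 2 * s\<^sup>2 * integral\<^sup>L M (\<lambda>x. (u x)\<^sup>2)"
    using no_spectral_gap[OF tp \<kappa>, where n = n and g = g] by blast
  define A where "A = integral\<^sup>L M (\<lambda>x. (u x)\<^sup>2)"
  have nn: "0 \<le> integral\<^sup>L M (\<lambda>x. (u (g i + x) - u x)\<^sup>2)" for i by simp
  then have "0 \<le> (\<Sum>i<n. integral\<^sup>L M (\<lambda>x. (u (g i + x) - u x)\<^sup>2))" by (rule sum_nonneg)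
  then have "0 < 2 * s\<^sup>2 * A" using u(2) unfolding A_def by linarith
  then have A: "A > 0" using \<kappa>(1) by (simp add: zero_less_mult_iff)
  show ?thesis
  proof (rule that[of "\<lambda>x. (u x)\<^sup>2"])
    show "(\<lambda>x. (u x)\<^sup>2) \<in> Cc" by (rule Cc_power2[OF u(1)])
    show "0 < integral\<^sup>L M (\<lambda>x. (u x)\<^sup>2)" using A by (simp add: A_def)
    fix i assume i: "i < n"
    have u2: "integrable M (\<lambda>x. (u x)\<^sup>2)" by (rule Cc_integrable[OF Cc_power2[OF u(1)]])
    have ug2: "integrable M (\<lambda>x. (u (g i + x))\<^sup>2)"
      by (rule Cc_integrable[OF Cc_power2[OF Cc_left[OF u(1)]]])
    have ud2: "integrable M (\<lambda>x. (u (g i + x) - u x)\<^sup>2)"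
      by (rule Cc_integrable[OF Cc_power2[OF Cc_diff[OF Cc_left[OF u(1)] u(1)]]])
    have inv: "integral\<^sup>L M (\<lambda>x. (u (g i + x))\<^sup>2) = A" unfolding A_def
      by (rule integral_left_translation[OF Cc_measurable[OF Cc_power2[OF u(1)]]])
    have "integral\<^sup>L M (\<lambda>x. (u (g i + x) - u x)\<^sup>2) \<le> (\<Sum>i<n. integral\<^sup>L M (\<lambda>x. (u (g i + x) - u x)\<^sup>2))"
      by (rule member_le_sum) (use i nn in auto)
    then have d: "integral\<^sup>L M (\<lambda>x. (u (g i + x) - u x)\<^sup>2) \<le> 2 * s\<^sup>2 * A"
      using u(2) unfolding A_def by linarith
    have pw: "\<bar>a\<^sup>2 - b\<^sup>2\<bar> \<le> 1 / (2 * s) * (a - b)\<^sup>2 + s * (a\<^sup>2 + b\<^sup>2)" for a b :: real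
    proof -
      have 1: "0 \<le> (\<bar>a - b\<bar> - s * \<bar>a + b\<bar>)\<^sup>2" by simp
      have "2 * s * \<bar>a\<^sup>2 - b\<^sup>2\<bar> = 2 * s * (\<bar>a - b\<bar> * \<bar>a + b\<bar>)"
        by (simp add: abs_mult[symmetric] power2_eq_square algebra_simps)
      also have "\<dots> \<le> (a - b)\<^sup>2 + s\<^sup>2 * (a + b)\<^sup>2"
        using 1 by (simp add: power2_diff power_mult_distrib mult_ac)
      also have "\<dots> \<le> (a - b)\<^sup>2 + s\<^sup>2 * (2 * (a\<^sup>2 + b\<^sup>2))"
      proof -
        have "2 * (a\<^sup>2 + b\<^sup>2) - (a + b)\<^sup>2 = (a - b)\<^sup>2" by (simp add: power2_eq_square algebra_simps)
        then have "(a + b)\<^sup>2 \<le> 2 * (a\<^sup>2 + b\<^sup>2)" by (metis diff_ge_0_iff_ge zero_le_power2)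
        then show ?thesis by (intro add_left_mono mult_left_mono) auto
      qed
      finally have "\<bar>a\<^sup>2 - b\<^sup>2\<bar> \<le> ((a - b)\<^sup>2 + s\<^sup>2 * (2 * (a\<^sup>2 + b\<^sup>2))) / (2 * s)"
        using s by (simp add: pos_le_divide_eq mult.commute)
      also have "\<dots> = 1 / (2 * s) * (a - b)\<^sup>2 + s * (a\<^sup>2 + b\<^sup>2)"
        using s by (simp add: field_simps power2_eq_square)
      finally show ?thesis .
    qed
    have "integral\<^sup>L M (\<lambda>x. \<bar>(u (g i + x))\<^sup>2 - (u x)\<^sup>2\<bar>)
      \<le> integral\<^sup>L M (\<lambda>x. 1 / (2 * s) * (u (g i + x) - u x)\<^sup>2 + s * ((u (g i + x))\<^sup>2 + (u x)\<^sup>2))"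
      by (rule Bochner_Integration.integral_mono)
        (use u2 ug2 ud2 pw in \<open>auto intro!: integrable_abs Bochner_Integration.integrable_diff Bochner_Integration.integrable_add integrable_mult_right\<close>)
    also have "\<dots> = 1 / (2 * s) * integral\<^sup>L M (\<lambda>x. (u (g i + x) - u x)\<^sup>2) + s * (A + A)"
      using u2 ug2 ud2 inv by (simp add: A_def)
    also have "\<dots> \<le> 1 / (2 * s) * (2 * s\<^sup>2 * A) + s * (A + A)"
      using d s by (intro add_right_mono mult_left_mono) auto
    also have "\<dots> = \<epsilon> * A" using s(1) by (simp add: s_def field_simps power2_eq_square)
    finally show "integral\<^sup>L M (\<lambda>x. \<bar>(u (g i + x))\<^sup>2 - (u x)\<^sup>2\<bar>) \<le> \<epsilon> * integral\<^sup>L M (\<lambda>x. (u x)\<^sup>2)"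
      by (simp add: A_def)
  qed simp
qed

end

section \<open>The main implication\<close>

lemma bcontfun_add:
  fixes f h :: "'a::topological_space \<Rightarrow> real"
  assumes f: "f \<in> bcontfun" and h: "h \<in> bcontfun"
  shows "(\<lambda>x. f x + h x) \<in> bcontfun"
proof -
  obtain B where B: "B > 0" "\<And>x. \<bar>f x\<bar> \<le> B" by (rule bcontfun_bound[OF f]) (rule that)
  obtain C where C: "C > 0" "\<And>x. \<bar>h x\<bar> \<le> C" by (rule bcontfun_bound[OF h]) (rule that)
  show ?thesis
  proof (rule bcontfunI_bound)
    show "continuous_on UNIV (\<lambda>x. f x + h x)"
      using f h by (intro continuous_on_add) (auto simp: bcontfun_def)
    show "\<bar>f x + h x\<bar> \<le> B + C" for x using B(2)[of x] C(2)[of x] by linarith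
  qed
qed

lemma bcontfun_cmult:
  fixes f :: "'a::topological_space \<Rightarrow> real"
  assumes f: "f \<in> bcontfun"
  shows "(\<lambda>x. c * f x) \<in> bcontfun"
proof -
  obtain B where B: "B > 0" "\<And>x. \<bar>f x\<bar> \<le> B" by (rule bcontfun_bound[OF f]) (rule that)
  show ?thesis
  proof (rule bcontfunI_bound)
    show "continuous_on UNIV (\<lambda>x. c * f x)"
      using f by (intro continuous_on_mult continuous_on_const) (auto simp: bcontfun_def)
    show "\<bar>c * f x\<bar> \<le> \<bar>c\<bar> * B" for x unfolding abs_mult by (intro mult_left_mono B) simp
  qed
qed

lemma bcontfun_sum:
  fixes f :: "'i \<Rightarrow> 'a::topological_space \<Rightarrow> real"
  assumes "\<And>i. i \<in> I \<Longrightarrow> f i \<in> bcontfun"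
  shows "(\<lambda>x. \<Sum>i\<in>I. f i x) \<in> bcontfun"
  using assms
  by (induction I rule: infinite_finite_induct) (auto intro: bcontfun_add const_bcontfun)

lemma bcontfun_left:
  fixes f :: "'a::topological_group_add \<Rightarrow> real"
  shows "f \<in> bcontfun \<Longrightarrow> (\<lambda>x. f (- a + x)) \<in> bcontfun"
  using left_translate_Cb[of f a] by (simp add: left_translate_def)

section \<open>Weighted averages of left translates\<close>

context haar_group
begin

text \<open>The argument is \<open>k + x\<close> and not \<open>- k + x\<close> as in
  \<open>conv\<close>. Translating \<open>E\<close> on the left is thereby absorbed into a left
  translation of the weight, without a modular factor.\<close>

definition slide :: "('a \<Rightarrow> real) \<Rightarrow> ('a \<Rightarrow> real) \<Rightarrow> 'a \<Rightarrow> real" where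
  "slide v E x = integral\<^sup>L M (\<lambda>k. v k * E (k + x))"

lemma slide_integrable:
  fixes v E :: "'a \<Rightarrow> real"
  assumes "v \<in> Cc" "E \<in> bcontfun"
  shows "integrable M (\<lambda>k. v k * E (k + x))"
proof (rule Cc_integrable[OF Cc_mult_continuous[OF assms(1)]])
  have E: "continuous_on UNIV E" using assms(2) by (simp add: bcontfun_def)
  show "continuous_on UNIV (\<lambda>k. E (k + x))"
    by (rule continuous_on_compose2[OF E]) (intro continuous_intros, simp)
qed

lemma slide_add:
  "v \<in> Cc \<Longrightarrow> w \<in> Cc \<Longrightarrow> E \<in> bcontfun \<Longrightarrow> slide (\<lambda>k. v k + w k) E x = slide v E x + slide w E x"
  unfolding slide_def by (simp add: distrib_right slide_integrable)

lemma slide_cmult: "slide (\<lambda>k. c * v k) E x = c * slide v E x"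
  unfolding slide_def by (simp add: mult.assoc)

lemma slide_sum:
  assumes "\<And>i. i \<in> I \<Longrightarrow> v i \<in> Cc" "E \<in> bcontfun"
  shows "slide (\<lambda>k. \<Sum>i\<in>I. v i k) E x = (\<Sum>i\<in>I. slide (v i) E x)"
  unfolding slide_def sum_distrib_right
  by (rule Bochner_Integration.integral_sum) (use assms slide_integrable in auto)

lemma slide_add_right:
  "v \<in> Cc \<Longrightarrow> E \<in> bcontfun \<Longrightarrow> E' \<in> bcontfun \<Longrightarrow> slide v (\<lambda>y. E y + E' y) x = slide v E x + slide v E' x"
  unfolding slide_def by (simp add: distrib_left slide_integrable)

lemma slide_cmult_right: "slide v (\<lambda>y. c * E y) x = c * slide v E x"
  unfolding slide_def by (simp add: mult.left_commute[of _ c])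

lemma slide_sum_right:
  assumes "v \<in> Cc" "\<And>i. i \<in> I \<Longrightarrow> E i \<in> bcontfun"
  shows "slide v (\<lambda>y. \<Sum>i\<in>I. E i y) x = (\<Sum>i\<in>I. slide v (E i) x)"
  unfolding slide_def sum_distrib_left
  by (rule Bochner_Integration.integral_sum) (use assms slide_integrable in auto)

lemma slide_mono:
  assumes "v \<in> Cc" "w \<in> Cc" "E \<in> bcontfun" "\<And>y. 0 \<le> E y" "\<And>k. v k \<le> w k"
  shows "slide v E x \<le> slide w E x"
  unfolding slide_def
  by (rule Bochner_Integration.integral_mono)
    (use assms slide_integrable in \<open>auto intro!: mult_right_mono\<close>)

lemma slide_mono_right:
  assumes "v \<in> Cc" "E \<in> bcontfun" "E' \<in> bcontfun" "\<And>k. 0 \<le> v k" "\<And>y. E y \<le> E' y"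
  shows "slide v E x \<le> slide v E' x"
  unfolding slide_def
  by (rule Bochner_Integration.integral_mono)
    (use assms slide_integrable in \<open>auto intro!: mult_left_mono\<close>)

lemma slide_translate:
  assumes "v \<in> Cc" "E \<in> bcontfun"
  shows "slide v (\<lambda>y. E (- a + y)) x = slide (\<lambda>k. v (a + k)) E x"
proof -
  have "(\<lambda>k. v k * E (- a + (k + x))) \<in> borel_measurable borel"
    using slide_integrable[OF assms(1) bcontfun_left[OF assms(2)], THEN borel_measurable_integrable] by simp
  from integral_left_translation[OF this, of a] show ?thesis
    unfolding slide_def by (simp only: add.assoc minus_add_cancel)
qed

lemma slide_translates:
  assumes "v \<in> Cc" "E \<in> bcontfun"
  shows "slide v (\<lambda>y. \<Sum>i\<in>I. b i * E (- a i + y)) x = slide (\<lambda>k. \<Sum>i\<in>I. b i * v (a i + k)) E x"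
proof -
  have "slide v (\<lambda>y. \<Sum>i\<in>I. b i * E (- a i + y)) x = (\<Sum>i\<in>I. slide v (\<lambda>y. b i * E (- a i + y)) x)"
    by (intro slide_sum_right assms bcontfun_cmult bcontfun_left)
  also have "\<dots> = (\<Sum>i\<in>I. slide (\<lambda>k. b i * v (a i + k)) E x)"
    by (simp only: slide_cmult_right slide_cmult slide_translate[OF assms])
  also have "\<dots> = slide (\<lambda>k. \<Sum>i\<in>I. b i * v (a i + k)) E x"
    by (intro slide_sum[symmetric] assms Cc_cmult Cc_left)
  finally show ?thesis .
qed

text \<open>Since \<open>- g + (- h + x) = - (h + g) + x\<close>, a left translation of
  \<open>f\<close> is a right translation of the integrand in \<open>h\<close>; undoing it produces
  the modular factor.\<close>

lemma conv_translated_right: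
  assumes D: "\<And>u. u \<in> Cc \<Longrightarrow> integral\<^sup>L M (\<lambda>x. u (x + g)) = D * integral\<^sup>L M u"
    and \<phi>: "\<phi> \<in> Cc" and f: "f \<in> bcontfun"
  shows "conv \<phi> (\<lambda>x. f (- g + x)) x = D * conv (\<lambda>h. \<phi> (h + - g)) f x"
  using D[OF conv_integrand_Cc[OF Cc_right[OF \<phi>] f], of "- g" x]
  unfolding conv_def by (simp only: minus_add add.assoc right_minus add_0_right)

lemma integral_right_translated:
  assumes D: "\<And>u. u \<in> Cc \<Longrightarrow> integral\<^sup>L M (\<lambda>x. u (x + g)) = D * integral\<^sup>L M u"
    and \<phi>: "\<phi> \<in> Cc"
  shows "D * integral\<^sup>L M (\<lambda>h. \<phi> (h + - g)) = integral\<^sup>L M \<phi>"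
  using D[OF Cc_right[OF \<phi>], of "- g"] by (simp add: add.assoc)

text \<open>The choices depend on each other in one direction: \<open>\<epsilon>\<close> determines
  \<open>\<psi>\<close>, \<open>b\<close> and \<open>y\<close>, these determine \<open>Q\<close>,
  and \<open>Q\<close> determines \<open>\<delta>\<close> and \<open>\<theta>\<close>. The two
  resulting errors may each use up a third of \<open>- T\<close>.\<close>

lemma translate_property_Cb_u_imp_Cb_lu:
  assumes tp: "translate_property (Cb_u :: ('a \<Rightarrow> real) set) top"
  shows "translate_property (Cb_lu :: ('a \<Rightarrow> real) set) top"
  unfolding translate_property_def eventually_top left_translate_def
proof (intro ballI allI impI, rule ccontr)
  fix f :: "'a \<Rightarrow> real" and n :: nat and t :: "nat \<Rightarrow> real" and g :: "nat \<Rightarrow> 'a"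
  assume f: "f \<in> Cb_lu" "\<not> (\<forall>x. f x = 0)" "\<forall>x. 0 \<le> f x"
    and pos: "\<forall>x. 0 \<le> (\<Sum>j<n. t j * f (- g j + x))" and neg: "\<not> 0 \<le> (\<Sum>j<n. t j)"
  define T where "T = (\<Sum>j<n. t j)"
  have T: "T < 0" using neg by (simp add: T_def)
  have f0: "0 \<le> f x" for x using f(3) by blast
  obtain a where a: "f a \<noteq> 0" using f(2) by blast
  have fC: "f \<in> bcontfun" using f(1) by (simp add: Cb_lu_def)
  obtain \<phi> :: "'a \<Rightarrow> real" where \<phi>: "\<phi> \<in> Cc" "\<And>x. 0 \<le> \<phi> x" "\<phi> 0 = 1"
    by (rule bump_UNIV) (rule that)
  have \<phi>0: "\<phi> 0 > 0" using \<phi>(3) by simp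
  define F where "F = conv \<phi> f"
  have FC: "F \<in> bcontfun" using conv_Cb_u[OF \<phi>(1) f(1) f0] by (simp add: F_def Cb_u_def Cb_ru_def)
  have F0: "0 \<le> F x" for x unfolding F_def by (rule conv_nonneg[OF \<phi>(2) f0])
  have "conv \<phi> f a > 0" unfolding conv_def
    by (rule integral_Cc_pos[OF conv_integrand_Cc[OF \<phi>(1) fC], of _ 0])
      (use \<phi> f0 a in \<open>simp_all add: order_less_le\<close>)
  then have Fa: "conv \<phi> f a \<noteq> 0" by simp
  obtain D where D: "\<And>u g. u \<in> Cc \<Longrightarrow> integral\<^sup>L M (\<lambda>x. u (x + g)) = D g * integral\<^sup>L M u"
    by (rule modular_function) blast
  have D\<phi>: "D c * integral\<^sup>L M (\<lambda>h. \<phi> (h + - c)) = integral\<^sup>L M \<phi>" for c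
    by (rule integral_right_translated[OF D \<phi>(1)])
  have Df: "conv \<phi> (\<lambda>x. f (- c + x)) x = D c * conv (\<lambda>h. \<phi> (h + - c)) f x" for c x
    by (rule conv_translated_right[OF D \<phi>(1) fC])
  \<comment> \<open>Chosen so that \<open>conv \<kappa>1 f\<close> is the left convolution of
    \<open>\<phi>\<close> with the given nonnegative combination. By \<open>D\<phi>\<close> the
    modular factors cancel under the integral, leaving \<open>T\<close> times the integral of
    \<open>\<phi>\<close>.\<close>
  define \<kappa>1 where "\<kappa>1 h = (\<Sum>j<n. (t j * D (g j)) * \<phi> (h + - g j))" for h
  define \<kappa> where "\<kappa> h = \<kappa>1 h - T * \<phi> h" for h
  have \<kappa>1: "\<kappa>1 \<in> Cc" unfolding \<kappa>1_def by (intro Cc_sum Cc_cmult Cc_right \<phi>(1))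
  have T\<phi>: "(\<lambda>h. T * \<phi> h) \<in> Cc" by (rule Cc_cmult[OF \<phi>(1)])
  have \<kappa>: "\<kappa> \<in> Cc" unfolding \<kappa>_def by (intro Cc_diff \<kappa>1 T\<phi>)
  have "integral\<^sup>L M \<kappa>1 = (\<Sum>j<n. integral\<^sup>L M (\<lambda>h. (t j * D (g j)) * \<phi> (h + - g j)))"
    unfolding \<kappa>1_def
    by (rule Bochner_Integration.integral_sum) (intro Cc_integrable Cc_cmult Cc_right \<phi>(1))
  also have "\<dots> = (\<Sum>j<n. t j * (D (g j) * integral\<^sup>L M (\<lambda>h. \<phi> (h + - g j))))"
    by (simp only: integral_mult_right_zero mult.assoc)
  also have "\<dots> = T * integral\<^sup>L M \<phi>"
    unfolding D\<phi> by (simp only: T_def sum_distrib_right)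
  finally have \<kappa>0: "integral\<^sup>L M \<kappa> = 0"
    unfolding \<kappa>_def using Cc_integrable[OF \<kappa>1] Cc_integrable[OF T\<phi>] by simp
  have pos': "0 \<le> T * F x + conv \<kappa> f x" for x
  proof -
    have "conv \<kappa>1 f x = (\<Sum>j<n. t j * conv \<phi> (\<lambda>x. f (- g j + x)) x)"
      unfolding Df mult.assoc[symmetric] conv_cmult[symmetric] \<kappa>1_def
      by (intro conv_sum Cc_cmult Cc_right \<phi>(1) fC)
    also have "\<dots> = (\<Sum>j<n. integral\<^sup>L M (\<lambda>h. t j * (\<phi> h * f (- g j + (- h + x)))))"
      by (simp add: conv_def)
    also have "\<dots> = integral\<^sup>L M (\<lambda>h. \<Sum>j<n. t j * (\<phi> h * f (- g j + (- h + x))))"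
      by (rule Bochner_Integration.integral_sum[symmetric])
        (intro integrable_mult_right conv_integrable[OF \<phi>(1) bcontfun_left[OF fC]])
    also have "\<dots> = integral\<^sup>L M (\<lambda>h. \<phi> h * (\<Sum>j<n. t j * f (- g j + (- h + x))))"
      by (simp add: sum_distrib_left mult.left_commute)
    also have "\<dots> \<ge> 0" using \<phi>(2) pos by (intro Bochner_Integration.integral_nonneg mult_nonneg_nonneg) auto
    finally have "0 \<le> conv \<kappa>1 f x" .
    then show ?thesis
      unfolding \<kappa>_def conv_diff[OF \<kappa>1 T\<phi> fC] conv_cmult F_def by simp
  qed
  obtain C :: real and m :: nat and z where C: "C > 0" and
    ap: "\<And>\<epsilon>. \<epsilon> > 0 \<Longrightarrow> \<exists>\<psi> (n::nat) b y. \<psi> \<in> Cc \<and> (\<forall>x. 0 \<le> \<psi> x) \<and> (\<Sum>i<n. b i) = 0 \<and>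
       (\<forall>x. \<bar>\<kappa> x - (\<Sum>i<n. b i * \<psi> (- y i + x))\<bar> \<le> \<epsilon> * (C * (\<Sum>l<m. \<phi> (- z l + x))))"
    by (rule approx_by_translates[OF \<kappa> \<kappa>0 \<phi>(1,2) \<phi>0]) (rule that)
  \<comment> \<open>The approximation error has total coefficient
    \<open>\<epsilon> * C * real m\<close>, which becomes at most \<open>- T / 3\<close>; the added
    1 allows for \<open>m = 0\<close>.\<close>
  define \<epsilon> where "\<epsilon> = - T / (3 * (C * real m + 1))"
  have Cm: "C * real m \<ge> 0" using C by simp
  have \<epsilon>: "\<epsilon> > 0" unfolding \<epsilon>_def using T Cm by (intro divide_pos_pos) auto
  obtain \<psi> and N :: nat and b y where \<psi>: "\<psi> \<in> Cc" "\<And>x. 0 \<le> \<psi> x" and b: "(\<Sum>i<N. b i) = 0"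
    and near: "\<And>x. \<bar>\<kappa> x - (\<Sum>i<N. b i * \<psi> (- y i + x))\<bar> \<le> \<epsilon> * (C * (\<Sum>l<m. \<phi> (- z l + x)))"
    using ap[OF \<epsilon>] by blast
  obtain K where K: "compact K" "\<And>x. x \<notin> K \<Longrightarrow> \<psi> x = 0" by (rule CcE[OF \<psi>(1)]) (rule that)
  obtain B where B: "B > 0" "\<And>x. \<bar>\<psi> x\<bar> \<le> B" by (rule Cc_bounded[OF \<psi>(1)]) (rule that)
  \<comment> \<open>Prepares the bound of \<open>G = conv \<psi> f\<close> by translates of
    \<open>F\<close>, since the translate property will be applied to \<open>F\<close>
    alone.\<close>
  obtain C' :: real and m' :: nat and z' where
    C': "C' > 0" "\<And>x. x \<in> K \<Longrightarrow> 1 \<le> C' * (\<Sum>l<m'. \<phi> (- z' l + x))"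
    by (rule Cc_dominated_cover[OF \<phi>(1,2) \<phi>0 K(1)]) (rule that)
  define G where "G = conv \<psi> f"
  have GC: "G \<in> bcontfun" using conv_Cb_u[OF \<psi>(1) f(1) f0] by (simp add: G_def Cb_u_def Cb_ru_def)
  have G0: "0 \<le> G x" for x unfolding G_def by (rule conv_nonneg[OF \<psi>(2) f0])
  have tr_F: "conv (\<lambda>h. \<Sum>l\<in>I. c l * \<phi> (- z l + h)) f x = (\<Sum>l\<in>I. c l * F (- z l + x))"
    for I :: "nat set" and c z x unfolding F_def by (rule conv_translates[OF \<phi>(1) fC])
  have G_le: "G x \<le> (\<Sum>l<m'. (B * C') * F (- z' l + x))" for x
  proof -
    have "\<psi> h \<le> (\<Sum>l<m'. (B * C') * \<phi> (- z' l + h))" for h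
    proof (cases "h \<in> K")
      case True
      have "\<psi> h \<le> B * 1" using B(2)[of h] by simp
      also have "\<dots> \<le> B * (C' * (\<Sum>l<m'. \<phi> (- z' l + h)))"
        using C'(2)[OF True] B(1) by (intro mult_left_mono) auto
      finally show ?thesis by (simp add: sum_distrib_left mult.assoc)
    next
      case False
      then show ?thesis using K(2) B(1) C'(1) \<phi>(2) by (simp add: sum_nonneg)
    qed
    then show ?thesis unfolding tr_F[symmetric] G_def
      by (intro conv_mono \<psi>(1) fC f0 Cc_sum Cc_cmult Cc_left \<phi>(1))
  qed
  have ineq: "0 \<le> T * F x + ((\<Sum>i<N. b i * G (- y i + x)) + (\<Sum>l<m. (\<epsilon> * C) * F (- z l + x)))" for x
  proof -
    have "\<kappa> h \<le> (\<Sum>i<N. b i * \<psi> (- y i + h)) + (\<Sum>l<m. (\<epsilon> * C) * \<phi> (- z l + h))" for h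
      using near[of h] by (simp add: abs_le_iff sum_distrib_left mult.assoc)
    then have "conv \<kappa> f x \<le> conv (\<lambda>h. (\<Sum>i<N. b i * \<psi> (- y i + h)) + (\<Sum>l<m. (\<epsilon> * C) * \<phi> (- z l + h))) f x"
      by (intro conv_mono \<kappa> fC f0 Cc_add Cc_sum Cc_cmult Cc_left \<phi>(1) \<psi>(1))
    also have "\<dots> = (\<Sum>i<N. b i * G (- y i + x)) + (\<Sum>l<m. (\<epsilon> * C) * F (- z l + x))"
      unfolding tr_F[symmetric] G_def conv_translates[OF \<psi>(1) fC, symmetric]
      by (intro conv_add fC Cc_sum Cc_cmult Cc_left \<phi>(1) \<psi>(1))
    finally show ?thesis using pos'[of x] by linarith
  qed
  \<comment> \<open>\<open>B * C' * real m'\<close> is the total coefficient of the bound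
    \<open>G_le\<close>, and the coefficients \<open>b\<close> enter through the triangle
    inequality.\<close>
  define Q where "Q = B * C' * real m' * (\<Sum>i<N. \<bar>b i\<bar>)"
  have Q: "Q \<ge> 0" unfolding Q_def using B(1) C'(1) by (simp add: sum_nonneg)
  \<comment> \<open>The second entry makes \<open>\<delta> * Q\<close> at most
    \<open>- T / 3\<close>; the first meets the requirement of
    \<open>almost_invariant_function\<close>.\<close>
  define \<delta> where "\<delta> = min 1 (- T / (3 * (Q + 1)))"
  have \<delta>: "0 < \<delta>" "\<delta> \<le> 1" unfolding \<delta>_def using T Q divide_pos_pos[of "- T" "3 * (Q + 1)"] by auto
  obtain \<theta> where \<theta>: "\<theta> \<in> Cc" "\<And>x. 0 \<le> \<theta> x" "integral\<^sup>L M \<theta> > 0"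
    "\<And>i. i < N \<Longrightarrow> integral\<^sup>L M (\<lambda>x. \<bar>\<theta> (y i + x) - \<theta> x\<bar>) \<le> \<delta> * integral\<^sup>L M \<theta>"
    using almost_invariant_function[OF tp \<delta>, where n = N and g = y] by blast
  \<comment> \<open>Because the \<open>b i\<close> sum to zero, \<open>\<theta> k\<close> can be
    subtracted from each \<open>\<theta> (y i + k)\<close>. The absolute values make the weight
    nonnegative, as is needed to replace \<open>G\<close> by its upper bound.\<close>
  define \<eta> where "\<eta> k = (\<Sum>i<N. \<bar>b i\<bar> * \<bar>\<theta> (y i + k) - \<theta> k\<bar>)" for k
  have \<eta>: "\<eta> \<in> Cc" unfolding \<eta>_def by (intro Cc_sum Cc_cmult Cc_abs Cc_diff Cc_left \<theta>(1))
  have \<eta>0: "0 \<le> \<eta> k" for k unfolding \<eta>_def by (simp add: sum_nonneg)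
  define w1 where "w1 k = (\<Sum>l<m. (\<epsilon> * C) * \<theta> (z l + k))" for k
  define w2 where "w2 k = (\<Sum>l<m'. (B * C') * \<eta> (z' l + k))" for k
  have T\<theta>: "(\<lambda>k. T * \<theta> k) \<in> Cc" by (rule Cc_cmult[OF \<theta>(1)])
  have w1: "w1 \<in> Cc" unfolding w1_def by (intro Cc_sum Cc_cmult Cc_left \<theta>(1))
  have w2: "w2 \<in> Cc" unfolding w2_def by (intro Cc_sum Cc_cmult Cc_left \<eta>)
  have bF: "(\<lambda>x. T * F x) \<in> bcontfun" by (rule bcontfun_cmult[OF FC])
  have bG: "(\<lambda>x. \<Sum>i<N. b i * G (- y i + x)) \<in> bcontfun"
    by (intro bcontfun_sum bcontfun_cmult bcontfun_left GC)
  have bF': "(\<lambda>x. \<Sum>l<m. (\<epsilon> * C) * F (- z l + x)) \<in> bcontfun"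
    by (intro bcontfun_sum bcontfun_cmult bcontfun_left FC)
  \<comment> \<open>Averaging \<open>ineq\<close> with \<open>\<theta>\<close> moves all
    translations onto the weights. Replacing \<open>G\<close> by translates of \<open>F\<close>
    leaves one weighted average of \<open>F\<close>, to which
    \<open>translate_property_integral\<close> applies.\<close>
  have w_pos: "0 \<le> slide (\<lambda>k. T * \<theta> k + (w2 k + w1 k)) F x" for x
  proof -
    have "0 \<le> slide \<theta> (\<lambda>y'. T * F y' + ((\<Sum>i<N. b i * G (- y i + y')) + (\<Sum>l<m. (\<epsilon> * C) * F (- z l + y')))) x"
      unfolding slide_def using \<theta>(2) ineq by (intro Bochner_Integration.integral_nonneg mult_nonneg_nonneg) auto
    also have "\<dots> = T * slide \<theta> F x + (slide (\<lambda>k. \<Sum>i<N. b i * \<theta> (y i + k)) G x + slide w1 F x)"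
      unfolding w1_def slide_translates[OF \<theta>(1) FC, symmetric] slide_translates[OF \<theta>(1) GC, symmetric]
        slide_cmult_right[symmetric]
      unfolding slide_add_right[OF \<theta>(1) bF bcontfun_add[OF bG bF']] slide_add_right[OF \<theta>(1) bG bF'] ..
    also have "slide (\<lambda>k. \<Sum>i<N. b i * \<theta> (y i + k)) G x \<le> slide \<eta> G x"
    proof (rule slide_mono[OF _ \<eta> GC G0])
      show "(\<lambda>k. \<Sum>i<N. b i * \<theta> (y i + k)) \<in> Cc" by (intro Cc_sum Cc_cmult Cc_left \<theta>(1))
      fix k
      have "(\<Sum>i<N. b i * \<theta> (y i + k)) = (\<Sum>i<N. b i * (\<theta> (y i + k) - \<theta> k))"
        using b by (simp add: right_diff_distrib sum_subtractf sum_distrib_right[symmetric])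
      also have "\<dots> \<le> \<eta> k" unfolding \<eta>_def
        by (rule sum_mono) (simp add: abs_mult[symmetric])
      finally show "(\<Sum>i<N. b i * \<theta> (y i + k)) \<le> \<eta> k" .
    qed
    also have "slide \<eta> G x \<le> slide \<eta> (\<lambda>y. \<Sum>l<m'. (B * C') * F (- z' l + y)) x"
      by (intro slide_mono_right \<eta> GC \<eta>0 G_le bcontfun_sum bcontfun_cmult bcontfun_left FC)
    also have "\<dots> = slide w2 F x" unfolding w2_def by (rule slide_translates[OF \<eta> FC])
    also have "T * slide \<theta> F x + (slide w2 F x + slide w1 F x) = slide (\<lambda>k. T * \<theta> k + (w2 k + w1 k)) F x"
      by (simp add: slide_add[OF T\<theta> Cc_add[OF w2 w1] FC] slide_add[OF w2 w1 FC] slide_cmult)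
    finally show ?thesis by simp
  qed
  have w: "(\<lambda>k. T * \<theta> k + (w2 k + w1 k)) \<in> Cc" by (intro Cc_add T\<theta> w1 w2)
  have "0 \<le> integral\<^sup>L M (\<lambda>k. T * \<theta> k + (w2 k + w1 k))"
    by (rule translate_property_integral[OF tp \<phi>(1,2) \<phi>0 f(1) f0 Fa w])
      (rule w_pos[unfolded slide_def F_def])
  also have "\<dots> = T * integral\<^sup>L M \<theta> + (integral\<^sup>L M w2 + integral\<^sup>L M w1)"
    using Cc_integrable[OF \<theta>(1)] Cc_integrable[OF w1] Cc_integrable[OF w2] by simp
  also have "integral\<^sup>L M w1 = \<epsilon> * C * real m * integral\<^sup>L M \<theta>"
  proof -
    have "integral\<^sup>L M w1 = (\<Sum>l<m. integral\<^sup>L M (\<lambda>k. (\<epsilon> * C) * \<theta> (z l + k)))"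
      unfolding w1_def
      by (rule Bochner_Integration.integral_sum) (intro Cc_integrable Cc_cmult Cc_left \<theta>(1))
    then show ?thesis by (simp add: integral_left_translation[OF Cc_measurable[OF \<theta>(1)]])
  qed
  also have "integral\<^sup>L M w2 \<le> \<delta> * Q * integral\<^sup>L M \<theta>"
  proof -
    have "integral\<^sup>L M \<eta> = (\<Sum>i<N. integral\<^sup>L M (\<lambda>k. \<bar>b i\<bar> * \<bar>\<theta> (y i + k) - \<theta> k\<bar>))"
      unfolding \<eta>_def
      by (rule Bochner_Integration.integral_sum)
        (intro Cc_integrable Cc_cmult Cc_abs Cc_diff Cc_left \<theta>(1))
    also have "\<dots> \<le> (\<Sum>i<N. \<bar>b i\<bar> * (\<delta> * integral\<^sup>L M \<theta>))"
      using \<theta>(4) by (intro sum_mono) (simp add: mult_left_mono)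
    also have "\<dots> = \<delta> * integral\<^sup>L M \<theta> * (\<Sum>i<N. \<bar>b i\<bar>)"
      by (simp add: sum_distrib_right[symmetric] mult.commute)
    finally have \<eta>_le: "integral\<^sup>L M \<eta> \<le> \<delta> * integral\<^sup>L M \<theta> * (\<Sum>i<N. \<bar>b i\<bar>)" .
    have "integral\<^sup>L M w2 = (\<Sum>l<m'. integral\<^sup>L M (\<lambda>k. (B * C') * \<eta> (z' l + k)))"
      unfolding w2_def
      by (rule Bochner_Integration.integral_sum) (intro Cc_integrable Cc_cmult Cc_left \<eta>)
    also have "\<dots> = (B * C' * real m') * integral\<^sup>L M \<eta>"
      by (simp add: integral_left_translation[OF Cc_measurable[OF \<eta>]])
    also have "\<dots> \<le> (B * C' * real m') * (\<delta> * integral\<^sup>L M \<theta> * (\<Sum>i<N. \<bar>b i\<bar>))"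
      using B(1) C'(1) by (intro mult_left_mono \<eta>_le) auto
    also have "\<dots> = \<delta> * Q * integral\<^sup>L M \<theta>" by (simp add: Q_def mult_ac)
    finally show ?thesis .
  qed
  finally have "0 \<le> (T + \<delta> * Q + \<epsilon> * C * real m) * integral\<^sup>L M \<theta>"
    by (simp add: algebra_simps)
  then have "0 \<le> T + \<delta> * Q + \<epsilon> * C * real m" using \<theta>(3) by (simp add: zero_le_mult_iff)
  moreover have "\<delta> * Q \<le> - T / 3"
  proof -
    have "\<delta> * Q \<le> - T / (3 * (Q + 1)) * (Q + 1)"
      using Q T \<delta> unfolding \<delta>_def by (intro mult_mono) auto
    also have "\<dots> = - T / 3" using Q by (simp add: field_simps)
    finally show ?thesis .
  qed
  moreover have "\<epsilon> * C * real m \<le> - T / 3"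
  proof -
    have "\<epsilon> * (C * real m) \<le> \<epsilon> * (C * real m + 1)" using \<epsilon> by (intro mult_left_mono) auto
    also have "\<dots> = - T / 3" using Cm by (simp add: \<epsilon>_def field_simps)
    finally show ?thesis by (simp add: mult.assoc)
  qed
  ultimately show False using T by linarith
qed

end

theorem theorem8:
  fixes M :: "'a::{topological_group_add, t2_space} measure"
  assumes "locally_compact_space (euclidean :: 'a topology)"
    and "left_haar_measure M"
    and "translate_property Linf_fun (ae_filter M) \<or>
         translate_property (Cb :: ('a \<Rightarrow> real) set) top \<or>
         translate_property (Cb_lu :: ('a \<Rightarrow> real) set) top \<or>
         translate_property (Cb_ru :: ('a \<Rightarrow> real) set) top \<or>
         translate_property (Cb_u :: ('a \<Rightarrow> real) set) top"
  shows "translate_property Linf_fun (ae_filter M) \<and>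
         translate_property (Cb :: ('a \<Rightarrow> real) set) top \<and>
         translate_property (Cb_lu :: ('a \<Rightarrow> real) set) top \<and>
         translate_property (Cb_ru :: ('a \<Rightarrow> real) set) top \<and>
         translate_property (Cb_u :: ('a \<Rightarrow> real) set) top"
proof -
  interpret haar_group M by unfold_locales (rule assms)+
  have sub: "(Cb_lu :: ('a \<Rightarrow> real) set) \<subseteq> Cb" "(Cb_ru :: ('a \<Rightarrow> real) set) \<subseteq> Cb"
    "(Cb_u :: ('a \<Rightarrow> real) set) \<subseteq> Cb_lu" "(Cb_u :: ('a \<Rightarrow> real) set) \<subseteq> Cb_ru"
    by (auto simp: Cb_lu_def Cb_ru_def Cb_u_def)
  \<comment> \<open>Inclusions lead from \<open>Cb\<close> to \<open>Cb_lu\<close> and, through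
    \<open>Cb_ru\<close>, to \<open>Cb_u\<close>. The three implications proved above lead from
    \<open>Cb_u\<close> to \<open>Cb_lu\<close>, then to \<open>Linf_fun\<close> and back to
    \<open>Cb\<close>, which closes the circle.\<close>
  note down = sub[THEN translate_property_subset[rotated]]
  show ?thesis
    using assms(3) down translate_property_Linf_imp_Cb translate_property_Cb_lu_imp_Linf
      translate_property_Cb_u_imp_Cb_lu by blast
qed

end
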